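(* Let $n\geq 10$ and let $G$ be a graph attaining the maximum spectral radius among all connected nonregular graphs on $n$ vertices with maximum degree $4$. Then $G$ has degree sequence $(4,\ldots,4,2)$, i.e. all vertices but one have degree $4$ and the remaining vertex has degree $2$.
   Context: All graphs are finite, simple and undirected. The spectral radius of a graph is the largest eigenvalue of its adjacency matrix. A graph is nonregular if not all its vertices have the same degree. *)

theory Defs
  imports "Graph_Theory.Digraph_Component" "Jordan_Normal_Form.Spectral_Radius"
begin

text \<open>A finite simple undirected graph is a symmetric, loop-free, finite digraph
  without parallel arcs (\<^locale>\<open>pair_graph\<close>): an edge \<open>uv\<close> is the pair of arcs
  \<open>(u, v)\<close>, \<open>(v, u)\<close>.  Hence the degree of a vertex is its out-degree.\<close>

definition vdegree :: "'a pair_pre_digraph \<Rightarrow> 'a \<Rightarrow> nat" where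
  "vdegree G v = out_degree (with_proj G) v"

definition max_degree :: "'a pair_pre_digraph \<Rightarrow> nat" where
  "max_degree G = Max (vdegree G ` pverts G)"

definition nonregular :: "'a pair_pre_digraph \<Rightarrow> bool" where
  "nonregular G \<longleftrightarrow> (\<exists>u\<in>pverts G. \<exists>v\<in>pverts G. vdegree G u \<noteq> vdegree G v)"

definition connected_nonregular_graph :: "nat \<Rightarrow> nat \<Rightarrow> 'a pair_pre_digraph \<Rightarrow> bool" where
  "connected_nonregular_graph n \<Delta> G \<longleftrightarrow>
     pair_graph G \<and> card (pverts G) = n \<and> Digraph_Component.connected (with_proj G) \<and>
     nonregular G \<and> max_degree G = \<Delta>"

definition adjacency_mat_wrt :: "'a list \<Rightarrow> 'a pair_pre_digraph \<Rightarrow> real mat" where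
  "adjacency_mat_wrt xs G =
     mat (length xs) (length xs) (\<lambda>(i, j). if (xs ! i, xs ! j) \<in> parcs G then 1 else 0)"

text \<open>The vertices carry no order, so an arbitrary enumeration is chosen; by
  \<open>eigenvalue_adjacency_mat_iff\<close> below the eigenvalues do not depend on the choice.\<close>

definition adjacency_mat :: "'a pair_pre_digraph \<Rightarrow> real mat" where
  "adjacency_mat G = adjacency_mat_wrt (SOME xs. distinct xs \<and> set xs = pverts G) G"

text \<open>Not the library's \<^const>\<open>Spectral_Radius.spectral_radius\<close>, which is the maximum modulus
  of the eigenvalues of a complex matrix: this is the largest eigenvalue of the real matrix.\<close>

definition graph_spectral_radius :: "'a pair_pre_digraph \<Rightarrow> real" where
  "graph_spectral_radius G = Max (spectrum (adjacency_mat G))"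


lemma sum_nth_distinct:
  assumes "distinct xs"
  shows "(\<Sum>i<length xs. g (xs ! i)) = (\<Sum>v\<in>set xs. g v)"
  using sum.reindex_bij_betw[OF bij_betw_nth[OF assms refl refl], of g] by simp

lemma eigenvalue_adjacency_mat_wrt_iff:
  assumes xs: "distinct xs"
  shows "eigenvalue (adjacency_mat_wrt xs G) k \<longleftrightarrow>
    (\<exists>f. (\<exists>v\<in>set xs. f v \<noteq> 0) \<and>
         (\<forall>v\<in>set xs. (\<Sum>u\<in>set xs. if (v, u) \<in> parcs G then f u else 0) = k * f v))"
    (is "?L \<longleftrightarrow> ?R")
proof -
  define n where "n = length xs"
  define A where "A = adjacency_mat_wrt xs G"
  have dim: "dim_row A = n" "dim_col A = n"
    by (simp_all add: A_def adjacency_mat_wrt_def n_def)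
  have mv: "(A *\<^sub>v w) $ i = (\<Sum>u\<in>set xs. if (xs ! i, u) \<in> parcs G then f u else 0)"
    if i: "i < n" and w: "w \<in> carrier_vec n" and f: "\<And>j. j < n \<Longrightarrow> w $ j = f (xs ! j)"
    for w f i
  proof -
    have "(A *\<^sub>v w) $ i = (\<Sum>j<n. if (xs ! i, xs ! j) \<in> parcs G then f (xs ! j) else 0)"
      using i w by (auto simp: A_def adjacency_mat_wrt_def n_def scalar_prod_def lessThan_atLeast0
          f intro!: sum.cong)
    also have "\<dots> = (\<Sum>u\<in>set xs. if (xs ! i, u) \<in> parcs G then f u else 0)"
      unfolding n_def using sum_nth_distinct[OF xs, of "\<lambda>u. if (xs ! i, u) \<in> parcs G then f u else 0"] .
    finally show ?thesis .
  qed
  show ?thesis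
  proof
    assume ?L
    then obtain w where w: "w \<in> carrier_vec n" "w \<noteq> 0\<^sub>v n" "A *\<^sub>v w = k \<cdot>\<^sub>v w"
      by (auto simp: eigenvalue_def eigenvector_def A_def[symmetric] dim)
    define f where "f v = w $ (THE i. i < n \<and> xs ! i = v)" for v
    have f: "w $ j = f (xs ! j)" if "j < n" for j
    proof -
      have "(THE i. i < n \<and> xs ! i = xs ! j) = j"
        using that xs by (intro the_equality) (auto simp: n_def nth_eq_iff_index_eq)
      then show ?thesis by (simp add: f_def)
    qed
    obtain j where j: "j < n" "w $ j \<noteq> 0"
      using w(1,2) by (metis carrier_vecD eq_vecI index_zero_vec)
    have "\<exists>v\<in>set xs. f v \<noteq> 0"
      using j f by (intro bexI[of _ "xs ! j"]) (auto simp: n_def)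
    moreover have "(\<Sum>u\<in>set xs. if (v, u) \<in> parcs G then f u else 0) = k * f v"
      if v: "v \<in> set xs" for v
    proof -
      obtain i where i: "i < n" "v = xs ! i" using v by (auto simp: in_set_conv_nth n_def)
      have "(A *\<^sub>v w) $ i = k * w $ i"
        unfolding w(3) using carrier_vecD[OF w(1)] i(1) by simp
      then show ?thesis using mv[where f=f, OF i(1) w(1) f] f[OF i(1)] i(2) by simp
    qed
    ultimately show ?R by blast
  next
    assume ?R
    then obtain f v where v: "v \<in> set xs" "f v \<noteq> 0"
      and f: "\<And>v. v \<in> set xs \<Longrightarrow>
        (\<Sum>u\<in>set xs. if (v, u) \<in> parcs G then f u else 0) = k * f v"
      by blast
    define w where "w = vec n (\<lambda>i. f (xs ! i))"
    have w: "w \<in> carrier_vec n" "\<And>j. j < n \<Longrightarrow> w $ j = f (xs ! j)"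
      by (simp_all add: w_def)
    obtain i where i: "i < n" "v = xs ! i" using v(1) by (auto simp: in_set_conv_nth n_def)
    have "w \<noteq> 0\<^sub>v n" using i v w(2)[OF i(1)] by auto
    moreover have "A *\<^sub>v w = k \<cdot>\<^sub>v w"
    proof (rule eq_vecI)
      fix j assume "j < dim_vec (k \<cdot>\<^sub>v w)"
      then have j: "j < n" using w(1) by simp
      then have "xs ! j \<in> set xs" by (simp add: n_def)
      then show "(A *\<^sub>v w) $ j = (k \<cdot>\<^sub>v w) $ j"
        using mv[where f=f, OF j w] f[of "xs ! j"] carrier_vecD[OF w(1)] w(2)[OF j] j by simp
    qed (use w(1) dim in auto)
    ultimately show ?L
      using w(1) by (auto simp: eigenvalue_def eigenvector_def A_def[symmetric] dim)
  qed
qed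

lemma adjacency_mat_enum:
  assumes "finite (pverts G)"
  obtains xs where "distinct xs" "set xs = pverts G" "adjacency_mat G = adjacency_mat_wrt xs G"
proof -
  have "\<exists>xs. distinct xs \<and> set xs = pverts G"
    using finite_distinct_list[OF assms] by blast
  from someI_ex[OF this] show ?thesis
    using that unfolding adjacency_mat_def by blast
qed

lemma eigenvalue_adjacency_mat_iff:
  assumes "finite (pverts G)"
  shows "eigenvalue (adjacency_mat G) k \<longleftrightarrow>
    (\<exists>f. (\<exists>v\<in>pverts G. f v \<noteq> 0) \<and>
         (\<forall>v\<in>pverts G. (\<Sum>u\<in>pverts G. if (v, u) \<in> parcs G then f u else 0) = k * f v))"
proof -
  obtain xs where xs: "distinct xs" "set xs = pverts G" "adjacency_mat G = adjacency_mat_wrt xs G"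
    using adjacency_mat_enum[OF assms] .
  show ?thesis
    unfolding xs(3) eigenvalue_adjacency_mat_wrt_iff[OF xs(1)] xs(2) ..
qed

lemma spectrum_symmetric_real_mat_nonempty:
  fixes A :: "real mat"
  assumes A: "A \<in> carrier_mat n n" and n: "n > 0"
    and sym: "\<And>i j. i < n \<Longrightarrow> j < n \<Longrightarrow> A $$ (i, j) = A $$ (j, i)"
  shows "spectrum A \<noteq> {}"
proof -
  define B where "B = map_mat complex_of_real A"
  have B: "B \<in> carrier_mat n n" using A by (simp add: B_def)
  obtain k where k: "eigenvalue B k"
    using spectrum_non_empty[OF B n] by (auto simp: spectrum_def)
  then obtain v where v: "v \<in> carrier_vec n" "v \<noteq> 0\<^sub>v n" "B *\<^sub>v v = k \<cdot>\<^sub>v v"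
    using B by (auto simp: eigenvalue_def eigenvector_def)
  define S where "S = (\<Sum>i<n. \<Sum>j<n. of_real (A $$ (i, j)) * cnj (v $ i) * v $ j)"
  define N where "N = (\<Sum>i<n. (cmod (v $ i))\<^sup>2)"
  have row: "(\<Sum>j<n. of_real (A $$ (i, j)) * v $ j) = k * v $ i" if "i < n" for i
  proof -
    have "(B *\<^sub>v v) $ i = (\<Sum>j<n. of_real (A $$ (i, j)) * v $ j)"
      using that A v(1)
      by (auto simp: B_def scalar_prod_def lessThan_atLeast0 intro!: sum.cong)
    then show ?thesis using v that by simp
  qed
  have "S = (\<Sum>i<n. cnj (v $ i) * (\<Sum>j<n. of_real (A $$ (i, j)) * v $ j))"
    by (simp add: S_def sum_distrib_left algebra_simps)
  also have "\<dots> = (\<Sum>i<n. cnj (v $ i) * (k * v $ i))"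
    by (intro sum.cong refl) (simp add: row)
  also have "\<dots> = k * of_real N"
    by (simp add: N_def sum_distrib_left complex_norm_square algebra_simps del: of_real_power)
  finally have S: "S = k * of_real N" .
  have "cnj S = (\<Sum>i<n. \<Sum>j<n. of_real (A $$ (j, i)) * cnj (v $ j) * v $ i)"
    unfolding S_def cnj_sum
    by (intro sum.cong refl) (simp add: sym mult.commute mult.left_commute)
  also have "\<dots> = S" unfolding S_def by (rule sum.swap)
  finally have "S \<in> \<real>" by (simp add: Reals_cnj_iff)
  obtain j where j: "j < n" "v $ j \<noteq> 0"
    using v(1,2) by (metis carrier_vecD eq_vecI index_zero_vec)
  have "N > 0" unfolding N_def
    using j by (intro sum_pos2[of _ j]) auto
  then have "k = S / of_real N" using S by simp
  then have "k \<in> \<real>" using \<open>S \<in> \<real>\<close> by (metis Reals_divide Reals_of_real)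
  then obtain r where r: "k = of_real r" by (rule Reals_cases)
  have "poly (map_poly complex_of_real (char_poly A)) (of_real r) = 0"
    using k eigenvalue_root_char_poly[OF B] r
    by (simp add: B_def of_real_hom.char_poly_hom[OF A])
  then have "poly (char_poly A) r = 0" by simp
  then show ?thesis
    using eigenvalue_root_char_poly[OF A] by (auto simp: spectrum_def)
qed

lemma graph_spectral_radius_wellformed:
  assumes G: "pair_graph G" and ne: "pverts G \<noteq> {}"
  shows "finite (spectrum (adjacency_mat G))" "spectrum (adjacency_mat G) \<noteq> {}"
proof -
  interpret pair_graph G by (rule G)
  obtain xs where xs: "distinct xs" "set xs = pverts G" "adjacency_mat G = adjacency_mat_wrt xs G"
    using adjacency_mat_enum[OF pair_finite_verts] .
  have A: "adjacency_mat G \<in> carrier_mat (length xs) (length xs)"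
    by (simp add: xs adjacency_mat_wrt_def)
  show "finite (spectrum (adjacency_mat G))" by (rule card_finite_spectrum(1)[OF A])
  have "sym (parcs G)" using pair_sym_arcs by (simp add: symmetric_def)
  then have "adjacency_mat G $$ (i, j) = adjacency_mat G $$ (j, i)"
    if "i < length xs" "j < length xs" for i j
    using that by (auto simp: xs(3) adjacency_mat_wrt_def dest: symD)
  moreover have "length xs > 0" using xs ne by auto
  ultimately show "spectrum (adjacency_mat G) \<noteq> {}"
    using spectrum_symmetric_real_mat_nonempty[OF A] by blast
qed

end

theory Submission
  imports Defs "HOL-Analysis.Function_Topology"
begin

text \<open>Let \<open>x\<close> be the Perron vector of an extremal graph and \<open>l < 4\<close> its spectral radius.  If
  deleting and inserting some edges gives an admissible graph, then no test vector \<open>y\<close> may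
  have a Rayleigh quotient above \<open>l\<close> there.  Taking \<open>y = x\<close>, one first learns that the vertices of
  degree less than 4 form a clique (or are two vertices of degree 3, which can be excluded) and that
  an edge may not be moved to a deficient vertex with a larger entry.  With the parity of the degree
  sum this leaves, besides the claim, five small configurations: a pendant vertex, a triangle
  with degrees 2, 2, 4 or 2, 3, 3, and two vertices of degree 3 with the same other neighbours,
  adjacent or not.  Since \<open>x\<close> is strictly superharmonic at vertices of degree 4, it grows away
  from the deficient vertices; switching edges then shows that the two vertices just beyond a cut
  of two edges are adjacent (here \<open>n \<ge> 10\<close> is used).  After that every configuration can be
  rewired locally.  At \<open>l = 4\<close> several of these rewirings do not change the effective
  resistance from the deficient vertices to the rest, so \<open>y\<close> has to be chosen close to the
  optimum on the rewired part; the gain comes from the factor \<open>4 - l\<close>.\<close>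

section \<open>Editing the edges of a graph\<close>

text \<open>Two obstacles shape the proof. An edit has to keep the graph connected, so each removed
  edge needs a detour; in the cut argument, where none is in sight, parity provides it. And where a
  rewiring gains nothing in the limit \<open>l = 4\<close>, the new entries are solved for rather
  than guessed: away from the edit they stay those of \<open>x\<close>, on the altered vertices they
  come from the new eigenvalue equations. The gain is then a polynomial in \<open>l\<close> and a
  few unknown entries. Such an unknown is removed by giving the old and the new end of a moved edge
  the same value, or controlled through the known sum \<open>x p + x q\<close> and the inequality of
  the means. The hypothesis \<open>n \<ge> 10\<close> enters in two ways: with total deficiency at
  most 4 the average degree is at least 18/5, hence \<open>18 / 5 \<le> l < 4\<close>; and a set of
  at most 4 vertices leaves at least 6 others, one more than the exceptional configuration beyond a
  cut can hold.\<close>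

definition deg :: "'a rel \<Rightarrow> 'a \<Rightarrow> nat" where
  "deg A v = card (A `` {v})"

text \<open>The quadratic form of the adjacency matrix as a sum over arcs. Every edge counts twice,
  whence the factors 2 in \<open>quad_edit\<close>.\<close>

definition quad :: "'a rel \<Rightarrow> ('a \<Rightarrow> real) \<Rightarrow> real" where
  "quad A y = (\<Sum>(a, b)\<in>A. y a * y b)"

text \<open>The competitors as arc relations on a fixed vertex set, which makes an edit plain set
  algebra. Next to a vertex of degree 4, a vertex of smaller degree expresses nonregularity.\<close>

definition admissible :: "'a set \<Rightarrow> 'a rel \<Rightarrow> bool" where
  "admissible V A \<longleftrightarrow> A \<subseteq> V \<times> V \<and> sym A \<and> irrefl A \<and> V \<times> V \<subseteq> A\<^sup>* \<and>
     (\<forall>v\<in>V. deg A v \<le> 4) \<and> (\<exists>v\<in>V. deg A v = 4) \<and> (\<exists>v\<in>V. deg A v < 4)"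

text \<open>In an edge list every edge occurs once, in an arbitrary orientation.\<close>

definition arcs_of :: "('a \<times> 'a) list \<Rightarrow> ('a \<times> 'a) list" where
  "arcs_of es = es @ map prod.swap es"

definition edit :: "'a rel \<Rightarrow> ('a \<times> 'a) list \<Rightarrow> ('a \<times> 'a) list \<Rightarrow> 'a rel" where
  "edit A rs ns = (A - set (arcs_of rs)) \<union> set (arcs_of ns)"

definition inc :: "('a \<times> 'a) list \<Rightarrow> 'a \<Rightarrow> nat" where
  "inc es v = (\<Sum>(a, b)\<leftarrow>es. of_bool (a = v) + of_bool (b = v))"

definition quad_list :: "('a \<times> 'a) list \<Rightarrow> ('a \<Rightarrow> real) \<Rightarrow> real" where
  "quad_list es y = (\<Sum>(a, b)\<leftarrow>es. y a * y b)"

text \<open>The partial derivative of \<open>quad_list es y\<close> in the entry at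
  \<open>v\<close>, that is, the neighbour sum at \<open>v\<close> in the graph of the listed
  edges.\<close>

definition load :: "('a \<times> 'a) list \<Rightarrow> ('a \<Rightarrow> real) \<Rightarrow> 'a \<Rightarrow> real" where
  "load es y v = (\<Sum>(a, b)\<leftarrow>es. of_bool (a = v) * y b + of_bool (b = v) * y a)"

lemma inc_simps [simp]:
  "inc [] v = 0" "inc ((a, b) # es) v = of_bool (a = v) + of_bool (b = v) + inc es v"
  by (simp_all add: inc_def)

lemma quad_list_simps [simp]:
  "quad_list [] y = 0" "quad_list ((a, b) # es) y = y a * y b + quad_list es y"
  by (simp_all add: quad_list_def)

lemma load_simps [simp]:
  "load [] y v = 0"
  "load ((a, b) # es) y v = of_bool (a = v) * y b + of_bool (b = v) * y a + load es y v"
  by (simp_all add: load_def)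

lemma mem_edit [simp]:
  "(u, v) \<in> edit A rs ns \<longleftrightarrow>
     (u, v) \<in> A \<and> (u, v) \<notin> set rs \<and> (v, u) \<notin> set rs \<or> (u, v) \<in> set ns \<or> (v, u) \<in> set ns"
  by (force simp: edit_def arcs_of_def image_iff)

lemma distinct_arcs_of [simp]:
  "distinct (arcs_of [])"
  "distinct (arcs_of ((a, b) # es)) \<longleftrightarrow>
     a \<noteq> b \<and> (a, b) \<notin> set es \<and> (b, a) \<notin> set es \<and> distinct (arcs_of es)"
  by (force simp: arcs_of_def image_iff)+

lemma sum_arcs_of:
  fixes g :: "'a \<times> 'a \<Rightarrow> real"
  assumes "distinct (arcs_of es)"
  shows "sum g (set (arcs_of es)) = (\<Sum>(a, b)\<leftarrow>es. g (a, b) + g (b, a))"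
proof -
  have "sum g (set (arcs_of es)) = sum_list (map g (arcs_of es))"
    using assms by (simp add: sum.distinct_set_conv_list)
  also have "\<dots> = (\<Sum>(a, b)\<leftarrow>es. g (a, b) + g (b, a))"
    unfolding arcs_of_def by (induction es) auto
  finally show ?thesis .
qed

text \<open>Arbitrary arc weights, so that one computation serves both the degrees and the quadratic
  form.\<close>

lemma sum_edit:
  fixes g :: "'a \<times> 'a \<Rightarrow> real"
  assumes A: "finite A" "sym A"
    and rs: "distinct (arcs_of rs)" "set rs \<subseteq> A"
    and ns: "distinct (arcs_of ns)" "set ns \<inter> A = {}"
  shows "sum g (edit A rs ns) = sum g A - (\<Sum>(a, b)\<leftarrow>rs. g (a, b) + g (b, a))
           + (\<Sum>(a, b)\<leftarrow>ns. g (a, b) + g (b, a))"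
proof -
  have "set (arcs_of rs) \<subseteq> A" "set (arcs_of ns) \<inter> A = {}"
    using rs(2) ns(2) A(2) by (auto simp: arcs_of_def dest: symD)
  then have "sum g (edit A rs ns) =
      sum g A - sum g (set (arcs_of rs)) + sum g (set (arcs_of ns))"
    unfolding edit_def using A(1)
    by (subst sum.union_disjoint) (auto simp: sum_diff)
  then show ?thesis
    by (simp add: sum_arcs_of rs(1) ns(1))
qed

lemma sum_Image_eq:
  fixes f :: "'a \<Rightarrow> real"
  assumes "finite A"
  shows "(\<Sum>u\<in>A `` {v}. f u) = (\<Sum>(a, b)\<in>A. of_bool (a = v) * f b)"
proof -
  have "(\<Sum>(a, b)\<in>A. of_bool (a = v) * f b) = (\<Sum>(a, b)\<in>{e\<in>A. fst e = v}. f b)"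
    using assms by (intro sum.mono_neutral_cong_right) auto
  also have "\<dots> = (\<Sum>u\<in>A `` {v}. f u)"
    by (rule sum.reindex_bij_witness[of _ "\<lambda>u. (v, u)" snd]) auto
  finally show ?thesis by simp
qed

lemma real_deg_eq:
  assumes "finite A"
  shows "real (deg A v) = (\<Sum>(a, b)\<in>A. of_bool (a = v))"
  using sum_Image_eq[OF assms, of "\<lambda>_. 1" v] by (simp add: deg_def)

lemma finite_edit: "finite A \<Longrightarrow> finite (edit A rs ns)"
  by (simp add: edit_def)

lemma deg_edit:
  assumes "finite A" "sym A" "distinct (arcs_of rs)" "set rs \<subseteq> A"
    "distinct (arcs_of ns)" "set ns \<inter> A = {}"
  shows "deg (edit A rs ns) v + inc rs v = deg A v + inc ns v"
proof -
  have inc: "real (inc es v) = (\<Sum>(a, b)\<leftarrow>es. of_bool (a = v) + of_bool (b = v))" for es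
    by (induction es) auto
  have "real (deg (edit A rs ns) v) + real (inc rs v) = real (deg A v) + real (inc ns v)"
    unfolding real_deg_eq[OF finite_edit[OF assms(1)]] real_deg_eq[OF assms(1)] sum_edit[OF assms] inc
    by (simp add: case_prod_unfold)
  then show ?thesis by linarith
qed

lemma quad_edit:
  assumes "finite A" "sym A" "distinct (arcs_of rs)" "set rs \<subseteq> A"
    "distinct (arcs_of ns)" "set ns \<inter> A = {}"
  shows "quad (edit A rs ns) y = quad A y - 2 * quad_list rs y + 2 * quad_list ns y"
proof -
  have "2 * quad_list es y = (\<Sum>(a, b)\<leftarrow>es. y a * y b + y b * y a)" for es
    by (induction es) auto
  then show ?thesis
    unfolding quad_def sum_edit[OF assms] by (simp add: case_prod_unfold)
qed

lemma successively_rtrancl: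
  "successively (\<lambda>a b. (a, b) \<in> B) (a # ps) \<Longrightarrow> (a, last (a # ps)) \<in> B\<^sup>*"
  by (induction ps arbitrary: a) (auto intro: converse_rtrancl_into_rtrancl)

text \<open>Handshake: a new vertex \<open>r\<close> contributes the arcs to its neighbours in
  \<open>K\<close> together with their reversals.\<close>

lemma even_card_sym:
  assumes "finite K" "sym A" "irrefl A"
  shows "even (card (A \<inter> K \<times> K))"
  using assms(1)
proof (induction K)
  case (insert r K)
  let ?N = "A `` {r} \<inter> K"
  have "A \<inter> insert r K \<times> insert r K = (A \<inter> K \<times> K) \<union> ({r} \<times> ?N \<union> ?N \<times> {r})"
    using \<open>sym A\<close> \<open>irrefl A\<close> by (auto simp: irrefl_def dest: symD)
  moreover have "card ({r} \<times> ?N \<union> ?N \<times> {r}) = card ?N + card ?N"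
    using insert by (subst card_Un_disjoint) auto
  moreover have "(A \<inter> K \<times> K) \<inter> ({r} \<times> ?N \<union> ?N \<times> {r}) = {}"
    using insert by auto
  ultimately have "card (A \<inter> insert r K \<times> insert r K) = card (A \<inter> K \<times> K) + (card ?N + card ?N)"
    using insert.hyps(1) by (simp add: card_Un_disjoint)
  then show ?case
    using insert.IH by simp
qed auto

lemma sum_arcs_by_tail:
  fixes g :: "'a \<Rightarrow> 'a \<Rightarrow> real"
  assumes "finite V" "A \<subseteq> V \<times> V"
  shows "(\<Sum>(a, b)\<in>A. g a b) = (\<Sum>v\<in>V. \<Sum>u\<in>A `` {v}. g v u)"
proof -
  have A: "(SIGMA v:V. A `` {v}) = A" using assms(2) by auto
  have "finite A" using assms by (meson finite_SigmaI finite_subset)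
  then have "(\<Sum>v\<in>V. \<Sum>u\<in>A `` {v}. g v u) = (\<Sum>(a, b)\<in>(SIGMA v:V. A `` {v}). g a b)"
    using assms(1) by (intro sum.Sigma) auto
  then show ?thesis unfolding A by simp
qed

lemma rtrancl_closed:
  assumes "(v, w) \<in> A\<^sup>*" "v \<in> U" "\<And>a b. a \<in> U \<Longrightarrow> (a, b) \<in> A \<Longrightarrow> b \<in> U"
  shows "w \<in> U"
  using assms by (induction rule: rtrancl_induct) auto

lemma sum_deg:
  assumes "finite A" "A \<subseteq> V \<times> V" "finite V"
  shows "(\<Sum>v\<in>V. deg A v) = card A"
proof -
  have "(\<Sum>v\<in>V. deg A v) = card (SIGMA v:V. A `` {v})"
    unfolding deg_def using assms by (subst card_SigmaI) (auto intro: finite_Image)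
  also have "(SIGMA v:V. A `` {v}) = A" using assms(2) by auto
  finally show ?thesis .
qed

section \<open>Extremal graphs and test vectors\<close>

text \<open>All that is used of the spectral radius. As \<open>A\<close> itself is admissible,
  \<open>extr\<close> makes \<open>l\<close> the maximum of its own Rayleigh quotient, attained at
  the positive vector \<open>x\<close>.\<close>

locale extremal =
  fixes V :: "'a set" and A :: "'a rel" and x :: "'a \<Rightarrow> real" and l :: real
  assumes finV: "finite V" and card10: "10 \<le> card V"
    and adm: "admissible V A"
    and xpos: "v \<in> V \<Longrightarrow> x v > 0"
    and eigen: "v \<in> V \<Longrightarrow> (\<Sum>u\<in>A `` {v}. x u) = l * x v"
    and extr: "admissible V B \<Longrightarrow> quad B y \<le> l * (\<Sum>v\<in>V. (y v)\<^sup>2)"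
begin

lemma subV: "A \<subseteq> V \<times> V" and symA: "sym A" and irreflA: "irrefl A" and connA: "V \<times> V \<subseteq> A\<^sup>*"
  and deg_le: "v \<in> V \<Longrightarrow> deg A v \<le> 4" and ex_deg4: "\<exists>v\<in>V. deg A v = 4"
  and ex_deg_less: "\<exists>v\<in>V. deg A v < 4"
  using adm by (auto simp: admissible_def)

lemma finA: "finite A"
  using subV finV by (meson finite_SigmaI finite_subset)

lemma adj_sym: "(a, b) \<in> A \<longleftrightarrow> (b, a) \<in> A"
  using symA by (auto dest: symD)

lemma adj_irrefl [simp]: "(a, a) \<notin> A"
  using irreflA by (auto simp: irrefl_def)

lemma adj_inV: "(a, b) \<in> A \<Longrightarrow> a \<in> V \<and> b \<in> V"
  using subV by auto

text \<open>Everything is homogeneous in \<open>x\<close>; this permits \<open>x u = 1\<close> in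
  the explicit computations.\<close>

lemma scale: "c > 0 \<Longrightarrow> extremal V A (\<lambda>v. c * x v) l"
  by unfold_locales
    (auto simp: finV card10 adm xpos eigen extr simp flip: sum_distrib_left)

text \<open>Arcs not listed in \<open>rs\<close> survive, so connectedness only asks for a detour
  around each removed edge. The degree conditions are translated to the old degrees by
  \<open>deg_edit\<close>.\<close>

lemma admissible_edit:
  assumes rs: "distinct (arcs_of rs)" "set rs \<subseteq> A"
    and ns: "distinct (arcs_of ns)" "set ns \<inter> A = {}" "set ns \<subseteq> V \<times> V"
    and conn: "\<And>a b. (a, b) \<in> set rs \<Longrightarrow> (a, b) \<in> (edit A rs ns)\<^sup>*"
    and le: "\<And>v. v \<in> V \<Longrightarrow> deg A v + inc ns v \<le> 4 + inc rs v"
    and ex4: "\<exists>v\<in>V. deg A v + inc ns v = 4 + inc rs v"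
    and ex_less: "\<exists>v\<in>V. deg A v + inc ns v < 4 + inc rs v"
  shows "admissible V (edit A rs ns)"
proof -
  let ?B = "edit A rs ns"
  note deg = deg_edit[OF finA symA rs ns(1,2)]
  have symB: "sym ?B" by (auto simp: sym_def adj_sym)
  have "A \<subseteq> ?B\<^sup>*"
  proof (clarify)
    fix a b assume "(a, b) \<in> A"
    moreover have "(b, a) \<in> ?B\<^sup>* \<Longrightarrow> (a, b) \<in> ?B\<^sup>*"
      using symB by (meson sym_rtrancl symD)
    ultimately show "(a, b) \<in> ?B\<^sup>*"
      using conn by (cases "(a, b) \<in> ?B") auto
  qed
  then have "V \<times> V \<subseteq> ?B\<^sup>*"
    using connA rtrancl_subset_rtrancl by blast
  moreover have "?B \<subseteq> V \<times> V"
    using subV ns(3) by (auto simp: edit_def arcs_of_def)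
  moreover have "irrefl ?B"
  proof -
    have "distinct (arcs_of es) \<Longrightarrow> (a, a) \<notin> set es" for es and a :: 'a
      by (induction es) auto
    then show ?thesis using rs(1) ns(1) by (auto simp: irrefl_def)
  qed
  moreover have "deg ?B v \<le> 4" if "v \<in> V" for v using le[OF that] deg[of v] by linarith
  moreover have "\<exists>v\<in>V. deg ?B v = 4" using ex4 deg by (metis add_right_cancel)
  moreover have "\<exists>v\<in>V. deg ?B v < 4" using ex_less deg by (metis nat_add_left_cancel_less add.commute)
  ultimately show ?thesis using symB by (auto simp: admissible_def)
qed

text \<open>\<open>x\<close> lies in the kernel of \<open>A - l\<close>, so the form of
  \<open>A - l\<close> at \<open>x + z\<close> equals its form at \<open>z\<close>.\<close>

lemma quad_shift:
  "quad A (\<lambda>v. x v + z v) = quad A z + l * (\<Sum>v\<in>V. (x v + z v)\<^sup>2) - l * (\<Sum>v\<in>V. (z v)\<^sup>2)"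
proof -
  have lin: "(\<Sum>(a, b)\<in>A. f a * x b) = (\<Sum>v\<in>V. f v * (l * x v))" for f
  proof -
    have "(\<Sum>(a, b)\<in>A. f a * x b) = (\<Sum>v\<in>V. \<Sum>u\<in>A `` {v}. f v * x u)"
      by (rule sum_arcs_by_tail[OF finV subV])
    also have "\<dots> = (\<Sum>v\<in>V. f v * (l * x v))"
      by (intro sum.cong refl) (simp add: eigen flip: sum_distrib_left)
    finally show ?thesis .
  qed
  have swap: "(\<Sum>(a, b)\<in>A. x a * z b) = (\<Sum>(a, b)\<in>A. z a * x b)"
    by (rule sum.reindex_bij_witness[of _ prod.swap prod.swap]) (auto simp: adj_sym)
  have "quad A (\<lambda>v. x v + z v) = (\<Sum>(a, b)\<in>A. x a * x b) + (\<Sum>(a, b)\<in>A. x a * z b)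
      + (\<Sum>(a, b)\<in>A. z a * x b) + quad A z"
    unfolding quad_def sum.distrib[symmetric] by (intro sum.cong) (auto simp: algebra_simps)
  then show ?thesis
    unfolding swap lin
    by (simp add: algebra_simps power2_eq_square sum.distrib sum_distrib_left)
qed

text \<open>Reduces the form to a table over an explicit small set, which the simplifier can
  evaluate.\<close>

lemma quad_support:
  assumes "finite T" "\<And>v. v \<notin> T \<Longrightarrow> z v = 0"
  shows "quad A z = (\<Sum>s\<in>T. \<Sum>t\<in>T. if (s, t) \<in> A then z s * z t else 0)"
proof -
  have "quad A z = (\<Sum>(s, t)\<in>A \<inter> T \<times> T. z s * z t)"
    unfolding quad_def using assms finA by (intro sum.mono_neutral_right) (auto, blast+)
  also have "\<dots> = (\<Sum>(s, t)\<in>T \<times> T. if (s, t) \<in> A then z s * z t else 0)"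
    using assms(1) by (intro sum.mono_neutral_cong_left) (auto split: if_splits)
  also have "\<dots> = (\<Sum>s\<in>T. \<Sum>t\<in>T. if (s, t) \<in> A then z s * z t else 0)"
    by (rule sum.cartesian_product[symmetric])
  finally show ?thesis .
qed

text \<open>As \<open>A x = l x\<close>, only the deviation \<open>z\<close> from \<open>x\<close> and the edited edges matter: the
  comparison is local.\<close>
lemma edit_bound:
  assumes rs: "distinct (arcs_of rs)" "set rs \<subseteq> A"
    and ns: "distinct (arcs_of ns)" "set ns \<inter> A = {}"
    and adm': "admissible V (edit A rs ns)"
    and T: "finite T" "T \<subseteq> V" "\<And>v. v \<notin> T \<Longrightarrow> z v = 0"
  shows "(\<Sum>s\<in>T. \<Sum>t\<in>T. if (s, t) \<in> A then z s * z t else 0) - l * (\<Sum>s\<in>T. (z s)\<^sup>2)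
    + 2 * quad_list ns (\<lambda>v. x v + z v) \<le> 2 * quad_list rs (\<lambda>v. x v + z v)"
proof -
  have "(\<Sum>s\<in>T. (z s)\<^sup>2) = (\<Sum>s\<in>V. (z s)\<^sup>2)"
    using T finV by (intro sum.mono_neutral_left) auto
  then have "l * (\<Sum>s\<in>T. (z s)\<^sup>2) = l * (\<Sum>s\<in>V. (z s)\<^sup>2)" by simp
  moreover have "quad A z = (\<Sum>s\<in>T. \<Sum>t\<in>T. if (s, t) \<in> A then z s * z t else 0)"
    using T by (intro quad_support) auto
  ultimately show ?thesis
    using extr[OF adm', of "\<lambda>v. x v + z v"]
    unfolding quad_edit[OF finA symA rs ns] quad_shift by linarith
qed

lemma l_pos: "l > 0"
proof -
  obtain v where v: "v \<in> V" "deg A v = 4" using ex_deg4 by auto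
  then have "(\<Sum>u\<in>A `` {v}. x u) > 0"
    using adj_inV xpos by (intro sum_pos) (auto simp: deg_def intro: card_ge_0_finite)
  then show ?thesis using eigen[OF v(1)] xpos[OF v(1)] by (metis zero_less_mult_pos2)
qed

text \<open>If \<open>x\<close> itself loses nothing, then it maximises the Rayleigh quotient of the edited graph.\<close>
lemma edit_eigen:
  assumes rs: "distinct (arcs_of rs)" "set rs \<subseteq> A"
    and ns: "distinct (arcs_of ns)" "set ns \<inter> A = {}"
    and adm': "admissible V (edit A rs ns)"
    and ge: "quad_list rs x \<le> quad_list ns x" and r: "r \<in> V"
  shows "load ns x r = load rs x r"
proof (rule ccontr)
  define \<rho> where "\<rho> = load ns x r - load rs x r"
  assume "load ns x r \<noteq> load rs x r"
  then have \<rho>: "\<rho> \<noteq> 0" by (simp add: \<rho>_def)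
  have shift: "distinct (arcs_of es) \<Longrightarrow>
     quad_list es (\<lambda>v. x v + (if v = r then \<epsilon> else 0)) = quad_list es x + \<epsilon> * load es x r" for es \<epsilon>
    by (induction es) (auto simp: algebra_simps)
  have "- l * \<epsilon>\<^sup>2 + 2 * \<epsilon> * \<rho> \<le> 0" for \<epsilon>
    using edit_bound[OF rs ns adm', of "{r}" "\<lambda>v. if v = r then \<epsilon> else 0"] r ge
      shift[OF rs(1), of \<epsilon>] shift[OF ns(1), of \<epsilon>]
    by (simp add: \<rho>_def algebra_simps)
  \<comment> \<open>\<open>\<rho> / l\<close> maximises the left-hand side, with value
    \<open>\<rho>^2 / l\<close>.\<close>
  from this[of "\<rho> / l"] have "\<rho>\<^sup>2 \<le> 0" using l_pos
    by (simp add: power2_eq_square field_simps)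
  then show False using \<rho> by simp
qed

lemma adjD: "(a, b) \<in> A \<Longrightarrow> (b, a) \<in> A"
  using adj_sym by blast

lemma fin_nb: "finite (A `` {v})"
  using finA by (rule finite_Image)

text \<open>Summing the eigenvalue equations turns \<open>l\<close> times the sum of
  \<open>x\<close> into the degree-weighted sum of \<open>x\<close>; a deficient vertex pushes this
  strictly below 4 times the sum.\<close>

lemma l_less_4: "l < 4"
proof -
  have 1: "(\<Sum>(a, b)\<in>A. x b) = l * (\<Sum>v\<in>V. x v)"
    by (subst sum_arcs_by_tail[OF finV subV]) (simp add: eigen sum_distrib_left)
  have "(\<Sum>(a, b)\<in>A. x b) = (\<Sum>(a, b)\<in>A. x a)"
    by (rule sum.reindex_bij_witness[of _ prod.swap prod.swap]) (auto simp: adj_sym)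
  also have "\<dots> = (\<Sum>v\<in>V. deg A v * x v)"
    by (subst sum_arcs_by_tail[OF finV subV]) (simp add: deg_def)
  also have "\<dots> < (\<Sum>v\<in>V. 4 * x v)"
  proof (rule sum_strict_mono_ex1[OF finV])
    show "\<forall>v\<in>V. deg A v * x v \<le> 4 * x v"
      using deg_le xpos by (auto intro!: mult_right_mono less_imp_le)
    obtain v where "v \<in> V" "deg A v < 4" using ex_deg_less by auto
    then show "\<exists>v\<in>V. deg A v * x v < 4 * x v"
      using xpos[of v] by (intro bexI[of _ v]) auto
  qed
  finally have "l * (\<Sum>v\<in>V. x v) < 4 * (\<Sum>v\<in>V. x v)"
    unfolding 1 by (simp add: sum_distrib_left)
  moreover have "(\<Sum>v\<in>V. x v) \<ge> 0" using xpos by (auto intro: sum_nonneg less_imp_le)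
  ultimately show ?thesis by (metis mult_less_cancel_right_pos mult_zero_right not_less_iff_gr_or_eq less_le)
qed

text \<open>The all-ones vector shows that the average degree is at most \<open>l\<close>; a total
  deficiency of at most 4 on at least 10 vertices makes it at least 4 - 4/10.\<close>

lemma l_ge:
  assumes D: "D \<subseteq> V" "\<And>v. v \<in> V - D \<Longrightarrow> deg A v = 4" "4 * card D \<le> (\<Sum>v\<in>D. deg A v) + 4"
  shows "18 / 5 \<le> l"
proof -
  have "real (card A) \<le> l * real (card V)"
    using extr[OF adm, of "\<lambda>_. 1"] by (simp add: quad_def case_prod_unfold)
  moreover have "4 * card V \<le> card A + 4"
  proof -
    have "(\<Sum>v\<in>V. deg A v) = (\<Sum>v\<in>V - D. deg A v) + (\<Sum>v\<in>D. deg A v)"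
      by (rule sum.subset_diff[OF D(1) finV])
    also have "(\<Sum>v\<in>V - D. deg A v) = 4 * (card V - card D)"
      using D finV by (simp add: card_Diff_subset finite_subset)
    finally have "card A = 4 * (card V - card D) + (\<Sum>v\<in>D. deg A v)"
      using sum_deg[OF finA subV finV] by simp
    then show ?thesis using D(3) card_mono[OF finV D(1)] by linarith
  qed
  ultimately have "4 * real (card V) \<le> l * real (card V) + 4" by linarith
  moreover have "(4 - l) * 10 \<le> (4 - l) * real (card V)"
    using l_less_4 card10 by (intro mult_left_mono) auto
  ultimately show ?thesis unfolding left_diff_distrib by linarith
qed

section \<open>Minima of the Perron vector and switches of two edges\<close>

lemma closed_all:
  assumes "v \<in> U" "v \<in> V" "\<And>a b. a \<in> U \<Longrightarrow> (a, b) \<in> A \<Longrightarrow> b \<in> U"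
  shows "V \<subseteq> U"
proof
  fix w assume "w \<in> V"
  then have "(v, w) \<in> A\<^sup>*" using connA assms(2) by auto
  then show "w \<in> U" using assms(1,3) by (rule rtrancl_closed)
qed

text \<open>A vertex of degree 4 lies above the average of its neighbours because \<open>l < 4\<close>.\<close>
lemma local_min:
  assumes v: "v \<in> V" "deg A v = 4"
  shows "\<exists>u. (v, u) \<in> A \<and> x u < x v"
proof (rule ccontr)
  assume "\<not> ?thesis"
  then have "(\<Sum>u\<in>A `` {v}. x v) \<le> (\<Sum>u\<in>A `` {v}. x u)"
    by (intro sum_mono) (auto simp: not_less)
  then have "4 * x v \<le> l * x v"
    using v by (simp add: eigen deg_def)
  then show False using l_less_4 xpos[OF v(1)] by simp
qed

lemma ex_minimizer:
  assumes "U \<subseteq> V" "U \<noteq> {}"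
  obtains r where "r \<in> U" "\<And>u. u \<in> U \<Longrightarrow> x r \<le> x u"
proof -
  have "finite U" using assms(1) finV finite_subset by blast
  then show ?thesis
    using that[OF arg_min_if_finite(1)[of U x]] arg_min_least[of U _ x] assms(2) by blast
qed

lemma edit_path:
  "successively (\<lambda>a b. (a, b) \<in> edit A rs ns) (a # ps) \<Longrightarrow> last (a # ps) = b \<Longrightarrow>
     (a, b) \<in> (edit A rs ns)\<^sup>*"
  using successively_rtrancl[of "edit A rs ns" a ps] by simp

lemma admissible_edit_same_degrees:
  assumes "distinct (arcs_of rs)" "set rs \<subseteq> A"
    and "distinct (arcs_of ns)" "set ns \<inter> A = {}" "set ns \<subseteq> V \<times> V"
    and "\<And>a b. (a, b) \<in> set rs \<Longrightarrow> (a, b) \<in> (edit A rs ns)\<^sup>*"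
    and "\<And>v. inc ns v = inc rs v"
  shows "admissible V (edit A rs ns)"
  using assms deg_le ex_deg4 ex_deg_less by (intro admissible_edit) auto

text \<open>With test vector \<open>x\<close> the form changes by twice
  \<open>(x a - x d) * (x c - x b)\<close>. If this is not negative, \<open>edit_eigen\<close> at
  \<open>a\<close> and at \<open>b\<close> forces both factors to be 0.\<close>

lemma switch:
  assumes ab: "(a, b) \<in> A" and cd: "(c, d) \<in> A" and ac: "(a, c) \<notin> A" "a \<noteq> c"
    and bd: "(b, d) \<notin> A" "b \<noteq> d"
    and gain: "(x a - x d) * (x c - x b) \<ge> 0" "x a \<noteq> x d \<or> x c \<noteq> x b"
    and conn: "(a, b) \<in> (edit A [(a, b), (c, d)] [(a, c), (b, d)])\<^sup>*"
      "(c, d) \<in> (edit A [(a, b), (c, d)] [(a, c), (b, d)])\<^sup>*"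
  shows False
proof -
  have ne: "a \<noteq> b" "c \<noteq> d" "a \<noteq> d" "b \<noteq> c"
    using ab cd ac bd adjD by auto
  have V: "a \<in> V" "b \<in> V" "c \<in> V" "d \<in> V" using ab cd adj_inV by auto
  have rs: "distinct (arcs_of [(a, b), (c, d)])" "set [(a, b), (c, d)] \<subseteq> A"
    using ne ac bd ab cd by auto
  have ns: "distinct (arcs_of [(a, c), (b, d)])" "set [(a, c), (b, d)] \<inter> A = {}"
     "set [(a, c), (b, d)] \<subseteq> V \<times> V"
    using ne ac bd V by auto
  have "admissible V (edit A [(a, b), (c, d)] [(a, c), (b, d)])"
    using conn by (intro admissible_edit_same_degrees[OF rs ns]) auto
  moreover have "quad_list [(a, b), (c, d)] x \<le> quad_list [(a, c), (b, d)] x"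
    using gain(1) by (simp add: algebra_simps)
  ultimately have eq: "load [(a, c), (b, d)] x r = load [(a, b), (c, d)] x r" if "r \<in> V" for r
    using edit_eigen rs ns that by blast
  show False
    using eq[of a] eq[of b] V ne ac bd gain(2) by (auto split: if_splits)
qed

section \<open>Cuts of two edges\<close>

text \<open>If \<open>p\<close> and \<open>q\<close> were not adjacent, inserting \<open>pq\<close>
  would pay off: switches first force every further neighbour of \<open>p\<close> to equal or be
  adjacent to every further neighbour of \<open>q\<close>. Degree 4 then leaves two cases, too few
  vertices beyond the cut or a complete bipartite piece that can be rewired.\<close>

lemma two_cut:
  assumes S: "S \<subseteq> V" "s \<in> S" "t \<in> S" "p \<notin> S" "q \<notin> S" "p \<noteq> q" "(s, p) \<in> A" "(t, q) \<in> A"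
    and cut: "\<And>a b. a \<in> S \<Longrightarrow> b \<notin> S \<Longrightarrow> (a, b) \<in> A \<Longrightarrow> a = s \<and> b = p \<or> a = t \<and> b = q"
    and connS: "\<And>v. v \<in> S \<Longrightarrow> (s, v) \<in> (A \<inter> S \<times> S)\<^sup>*"
    and deg4: "\<And>v. v \<in> V - S \<Longrightarrow> deg A v = 4"
    and low: "x s < x p" "x t < x p" "x p \<le> x q"
    and big: "card (V - S) \<ge> 6"
  shows "(p, q) \<in> A"
proof (rule ccontr)
  assume npq: "(p, q) \<notin> A"
  have nqp: "(q, p) \<notin> A" using npq adjD by blast
  have V: "s \<in> V" "t \<in> V" "p \<in> V" "q \<in> V" using S adj_inV by auto
  have ps: "(p, s) \<in> A" "(q, t) \<in> A" using S adjD by auto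
  \<comment> \<open>Only \<open>p\<close> and \<open>q\<close> have neighbours in \<open>S\<close>,
    so by \<open>local_min\<close> no other vertex can be a minimum outside
    \<open>S\<close>.\<close>
  have above: "x p < x r" if r: "r \<in> V" "r \<notin> S" "r \<noteq> p" "r \<noteq> q" for r
  proof (rule ccontr)
    assume "\<not> x p < x r"
    obtain m where m: "m \<in> V - S" "\<And>u. u \<in> V - S \<Longrightarrow> x m \<le> x u"
      using ex_minimizer[of "V - S"] r by blast
    then have "x r \<le> x u" if "u \<in> V - S" for u
    proof (cases "m = p \<or> m = q")
      case True
      then have "x p \<le> x u" using m(2)[OF that] low(3) by auto
      then show ?thesis using \<open>\<not> x p < x r\<close> by simp
    next
      case False
      obtain u' where u': "(m, u') \<in> A" "x u' < x m"
        using local_min[of m] m(1) deg4[of m] by auto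
      then have "u' \<in> S" using m(2)[of u'] adj_inV by force
      then show ?thesis using cut[of u' m] adjD[OF u'(1)] m(1) False by auto
    qed
    moreover obtain u where u: "(r, u) \<in> A" "x u < x r"
      using local_min[of r] deg4[of r] r by auto
    ultimately have "u \<in> S" using adj_inV by force
    then show False using cut[of u r] adjD[OF u(1)] r by auto
  qed
  define P where "P = A `` {p} - {s}"
  define Q where "Q = A `` {q} - {t}"
  have notS: "P \<inter> S = {}" "Q \<inter> S = {}"
    using cut S adjD unfolding P_def Q_def by blast+
  have cardP: "card P = 3" and cardQ: "card Q = 3"
    using deg4[of p] deg4[of q] V S ps fin_nb by (auto simp: P_def Q_def deg_def)
  have PV: "P \<subseteq> V" "Q \<subseteq> V" using adj_inV by (auto simp: P_def Q_def)
  have ne: "p \<notin> P" "q \<notin> P" "p \<notin> Q" "q \<notin> Q"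
    using npq nqp by (auto simp: P_def Q_def)
  have st: "s \<noteq> p" "s \<noteq> q" "t \<noteq> p" "t \<noteq> q" using S by auto
  have finPQ: "finite P" "finite Q" by (auto simp: P_def Q_def fin_nb)
  have restr: "(A \<inter> U \<times> U)\<^sup>* \<subseteq> (edit A rs ns)\<^sup>*"
    if "\<And>a b. (a, b) \<in> set rs \<Longrightarrow> a \<notin> U \<or> b \<notin> U" for U rs ns
    using that by (intro rtrancl_mono) (auto; blast)
  \<comment> \<open>Otherwise replacing \<open>qt\<close>, \<open>pr\<close> by \<open>qp\<close>,
    \<open>tr\<close> gains \<open>(x q - x r) * (x p - x t) > 0\<close>.\<close>
  have step1: "x q \<le> x r" if r: "r \<in> P" for r
  proof (rule ccontr)
    assume "\<not> x q \<le> x r"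
    then have gain: "x q - x r > 0" by simp
    have r': "r \<notin> S" "(p, r) \<in> A" "r \<noteq> p" "r \<noteq> q" "r \<noteq> t" "r \<noteq> s"
      using r notS ne S by (auto simp: P_def)
    let ?B = "edit A [(q, t), (p, r)] [(q, p), (t, r)]"
    have "(s, t) \<in> ?B\<^sup>*"
      using connS[OF S(3)] restr[of "[(q, t), (p, r)]" S] S r' by auto
    moreover have "(q, p) \<in> ?B\<^sup>*" "(p, s) \<in> ?B\<^sup>*" "(t, r) \<in> ?B\<^sup>*"
      using ps r' S by (auto intro!: r_into_rtrancl)
    ultimately have "(q, t) \<in> ?B\<^sup>*" "(p, r) \<in> ?B\<^sup>*"
      by (meson rtrancl_trans)+
    moreover have "(t, r) \<notin> A" using cut[of t r] r' S by auto
    ultimately show False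
      using switch[of q t p r] nqp r' ps S low gain by (auto simp: less_eq_real_def)
  qed
  have step2: "a = b \<or> (a, b) \<in> A" if a: "a \<in> P" and b: "b \<in> Q" for a b
  proof (rule ccontr)
    assume nab: "\<not> ?thesis"
    \<comment> \<open>The gain \<open>(x p - x b) * (x q - x r)\<close> is a product of two factors
      that are not positive, so only disconnection can forbid this switch.\<close>
    have sw: "(p, r) \<notin> (edit A [(p, r), (q, b)] [(p, q), (r, b)])\<^sup>*"
      if r: "r \<in> P" "r \<noteq> b" "(r, b) \<notin> A" for r
    proof
      let ?B = "edit A [(p, r), (q, b)] [(p, q), (r, b)]"
      assume *: "(p, r) \<in> ?B\<^sup>*"
      have "(q, p) \<in> ?B\<^sup>*" "(r, b) \<in> ?B\<^sup>*" by (auto intro!: r_into_rtrancl)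
      then have "(q, b) \<in> ?B\<^sup>*" using * by (meson rtrancl_trans)
      moreover have "x p < x b" using above[of b] b ne notS PV by auto
      moreover have "(x p - x b) * (x q - x r) \<ge> 0"
        using step1[OF r(1)] \<open>x p < x b\<close> by (intro mult_nonpos_nonpos) auto
      moreover have "(p, r) \<in> A" "(q, b) \<in> A" using r b by (auto simp: P_def Q_def)
      ultimately show False
        using switch[of p r q b] * npq S r by auto
    qed
    have a': "a \<notin> S" "(p, a) \<in> A" "a \<noteq> p" "a \<noteq> q" "(a, p) \<in> A"
      and b': "b \<notin> S" "(q, b) \<in> A" "b \<noteq> p" "b \<noteq> q" "(b, q) \<in> A"
      using a b notS ne S adjD by (auto simp: P_def Q_def)
    define A0 where "A0 = A - {(p, a), (a, p), (q, b), (b, q)}"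
    have symA0: "sym A0" using adjD by (auto simp: A0_def sym_def)
    \<comment> \<open>The component of \<open>a\<close> after deleting \<open>pa\<close> and
      \<open>qb\<close>. It turns out to avoid \<open>S\<close>, \<open>p\<close> and
      \<open>q\<close>, so all its degrees are 4.\<close>
    define K where "K = {v. (a, v) \<in> A0\<^sup>*}"
    have A0_B: "A0\<^sup>* \<subseteq> (edit A [(p, a), (q, b)] [(p, q), (a, b)])\<^sup>*"
      by (intro rtrancl_mono) (auto simp: A0_def)
    have npa: "(p, a) \<notin> A0\<^sup>*" using sw[OF a] nab A0_B by auto
    have Kcl: "v \<in> K \<Longrightarrow> (v, w) \<in> A0 \<Longrightarrow> w \<in> K" for v w
      by (auto simp: K_def intro: rtrancl_into_rtrancl)
    have A0sym: "(v, w) \<in> A0\<^sup>* \<Longrightarrow> (w, v) \<in> A0\<^sup>*" for v w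
      using symA0 by (meson sym_rtrancl symD)
    have pK: "p \<notin> K" using npa A0sym by (auto simp: K_def)
    have "(s, p) \<in> A0" using S a' b' ps by (auto simp: A0_def)
    then have sK: "s \<notin> K" using Kcl pK by blast
    have SK: "v \<notin> K" if "v \<in> S" for v
    proof
      assume "v \<in> K"
      moreover have "(A \<inter> S \<times> S)\<^sup>* \<subseteq> A0\<^sup>*"
        using S by (intro rtrancl_mono) (auto simp: A0_def)
      ultimately have "(a, s) \<in> A0\<^sup>*"
        using connS[OF that] A0sym unfolding K_def by (metis (no_types, lifting) mem_Collect_eq rtrancl_trans subsetD)
      then show False using sK by (simp add: K_def)
    qed
    have "(q, t) \<in> A0" using ps a' b' S st by (auto simp: A0_def)
    then have qK: "q \<notin> K" using Kcl SK S(3) by blast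
    have aK: "a \<in> K" by (simp add: K_def)
    have KV: "K \<subseteq> V"
    proof
      fix v assume "v \<in> K"
      then have "(a, v) \<in> A0\<^sup>*" by (simp add: K_def)
      then show "v \<in> V"
        using a PV by (induction rule: rtrancl_induct) (auto simp: A0_def dest: adj_inV)
    qed
    have leave: "v = a \<and> w = p \<or> v = b \<and> w = q" if "v \<in> K" "w \<notin> K" "(v, w) \<in> A" for v w
      using that Kcl[of v w] pK qK by (auto simp: A0_def)
    have finK: "finite K" using KV finV finite_subset by blast
    \<comment> \<open>Otherwise \<open>pa\<close> would be a bridge, contradicting the handshake lemma on \<open>K\<close>.\<close>
    have bK: "b \<in> K"
    proof (rule ccontr)
      assume bK: "b \<notin> K"
      have "A \<inter> K \<times> V = (A \<inter> K \<times> K) \<union> {(a, p)}"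
        using leave bK aK a' V KV by auto
      moreover have "(a, p) \<notin> A \<inter> K \<times> K" using pK by auto
      ultimately have "card (A \<inter> K \<times> V) = card (A \<inter> K \<times> K) + 1"
        using finA by (simp add: card_insert_if)
      then have "odd (card (A \<inter> K \<times> V))"
        using even_card_sym[OF finK symA irreflA] by simp
      moreover have "card (A \<inter> K \<times> V) = (\<Sum>v\<in>K. deg A v)"
      proof -
        have "A \<inter> K \<times> V = (SIGMA v:K. A `` {v})" using subV by auto
        then show ?thesis by (simp add: deg_def finK fin_nb)
      qed
      moreover have "(\<Sum>v\<in>K. deg A v) = 4 * card K"
        using deg4 SK KV by (subst sum.cong[of K K _ "\<lambda>_. 4"]) auto
      ultimately show False by simp
    qed
    have ab: "(a, b) \<in> (A \<inter> K \<times> K)\<^sup>*"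
    proof -
      have "(a, b) \<in> A0\<^sup>*" using bK by (simp add: K_def)
      then have "(a, b) \<in> (A \<inter> K \<times> K)\<^sup>* \<and> b \<in> K"
      proof (induction rule: rtrancl_induct)
        case (step v w)
        moreover from step have "w \<in> K" using Kcl by blast
        moreover have "(v, w) \<in> A" using step by (simp add: A0_def)
        ultimately show ?case by (auto intro: rtrancl_into_rtrancl)
      qed (use aK in auto)
      then show ?thesis by simp
    qed
    \<comment> \<open>As \<open>K\<close> joins \<open>a\<close> to \<open>b\<close>, another
      neighbour \<open>r\<close> of \<open>p\<close> can be switched instead of \<open>a\<close>:
      the walk from \<open>p\<close> to \<open>a\<close>, through \<open>K\<close> to
      \<open>b\<close>, and along the new edge to \<open>r\<close> replaces
      \<open>pr\<close>.\<close>
    have "P - {a} \<noteq> {}" using cardP a by (metis card_Diff_singleton card.empty diff_Suc_1 numeral_3_eq_3 nat.simps(3))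
    then obtain r where r: "r \<in> P" "r \<noteq> a" by blast
    have r': "(p, r) \<in> A" "r \<noteq> p" "r \<noteq> q" using r ne by (auto simp: P_def)
    have "r \<notin> K"
    proof
      assume "r \<in> K"
      moreover have "(r, p) \<in> A0" using r' r a' b' S adjD by (auto simp: A0_def)
      ultimately show False using Kcl pK by blast
    qed
    have rb: "r \<noteq> b" "(r, b) \<notin> A"
      using \<open>r \<notin> K\<close> bK leave[of b r] r' adjD by auto
    let ?B = "edit A [(p, r), (q, b)] [(p, q), (r, b)]"
    have "(a, b) \<in> ?B\<^sup>*" using ab restr[of "[(p, r), (q, b)]" K] pK qK by auto
    moreover have "(p, a) \<in> ?B\<^sup>*" "(b, r) \<in> ?B\<^sup>*"
      using a' r r' S by (auto intro!: r_into_rtrancl)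
    ultimately have "(p, r) \<in> ?B\<^sup>*" by (meson rtrancl_trans)
    then show False using sw[OF r(1) rb] by simp
  qed
  have nbP: "A `` {p} = insert s P" and nbQ: "A `` {q} = insert t Q"
    using ps by (auto simp: P_def Q_def)
  \<comment> \<open>Here \<open>big\<close> is spent: at most 2 + 3 vertices would lie outside
    \<open>S\<close>.\<close>
  have closed: False if "\<And>r. r \<in> P \<union> Q \<Longrightarrow> A `` {r} \<subseteq> {p, q} \<union> P \<union> Q" "card (P \<union> Q) \<le> 3"
  proof -
    have "V \<subseteq> S \<union> ({p, q} \<union> P \<union> Q)"
    proof (rule closed_all[of s])
      fix a b assume "a \<in> S \<union> ({p, q} \<union> P \<union> Q)" "(a, b) \<in> A"
      then show "b \<in> S \<union> ({p, q} \<union> P \<union> Q)"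
      proof -
        have "a = p \<Longrightarrow> b = s \<or> b \<in> P" "a = q \<Longrightarrow> b = t \<or> b \<in> Q"
          "a \<in> P \<union> Q \<Longrightarrow> b \<in> {p, q} \<union> P \<union> Q"
          using \<open>(a, b) \<in> A\<close> that(1)[of a] by (auto simp: P_def Q_def)
        then show ?thesis
          using cut[OF _ _ \<open>(a, b) \<in> A\<close>] \<open>a \<in> _\<close> S by blast
      qed
    qed (use S in auto)
    then have "card (V - S) \<le> card ({p, q} \<union> (P \<union> Q))"
      using finPQ by (intro card_mono) auto
    also have "\<dots> \<le> card {p, q} + card (P \<union> Q)" by (rule card_Un_le)
    also have "\<dots> \<le> 5" using that(2) S by simp
    finally show False using big by simp
  qed
  have deg_r: "card (A `` {r}) = 4" if "r \<in> P \<union> Q" for r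
    using deg4[of r] that PV notS by (auto simp: deg_def)
  show False
  proof (cases "P \<inter> Q = {}")
    case False
    then obtain r where r: "r \<in> P" "r \<in> Q" by auto
    \<comment> \<open>A common neighbour \<open>r\<close> sees \<open>p\<close>, \<open>q\<close>
      and all the rest of \<open>P \<union> Q\<close>, so degree 4 leaves at most three vertices in
      \<open>P \<union> Q\<close>.\<close>
    have sub: "insert p (insert q (P \<union> Q - {r})) \<subseteq> A `` {r}"
      using r step2[of _ r] step2[of r] adjD by (auto simp: P_def Q_def)
    have "card (insert p (insert q (P \<union> Q - {r}))) = 2 + card (P \<union> Q - {r})"
      using ne S finPQ by simp
    then have "card (P \<union> Q - {r}) \<le> 2"
      using card_mono[OF fin_nb sub] deg_r r by simp
    then have "card (P \<union> Q) \<le> 3" using r finPQ by simp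
    then have "P \<union> Q = P" "P \<union> Q = Q"
      using cardP cardQ finPQ card_seteq[of "P \<union> Q" P] card_seteq[of "P \<union> Q" Q] by auto
    then have PQ: "P = Q" by auto
    have "A `` {w} \<subseteq> {p, q} \<union> P \<union> Q" if w: "w \<in> P \<union> Q" for w
    proof -
      have "insert p (insert q (P - {w})) \<subseteq> A `` {w}"
      proof -
        have w': "w \<in> P" "w \<in> Q" using w PQ by auto
        then have "(w, p) \<in> A" "(w, q) \<in> A" using adjD by (simp_all add: P_def Q_def)
        moreover have "P - {w} \<subseteq> A `` {w}" using w' PQ step2[of w] by auto
        ultimately show ?thesis by simp
      qed
      moreover have "card (insert p (insert q (P - {w}))) = 4"
        using w PQ ne S finPQ cardP by simp
      ultimately have "insert p (insert q (P - {w})) = A `` {w}"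
        using card_seteq[OF fin_nb, of "insert p (insert q (P - {w}))" w] deg_r[OF w] by simp
      then show ?thesis by blast
    qed
    then show False using closed cardP PQ by simp
  next
    case True
    have nP: "A `` {w} = insert p Q" if w: "w \<in> P" for w
    proof -
      have "insert p Q \<subseteq> A `` {w}"
        using w True step2[of w] adjD by (auto simp: P_def)
      moreover have "card (insert p Q) = 4" using ne finPQ cardQ by simp
      ultimately show ?thesis
        using card_seteq[OF fin_nb, of "insert p Q" w] deg_r[of w] w by simp
    qed
    have nQ: "A `` {w} = insert q P" if w: "w \<in> Q" for w
    proof -
      have "insert q P \<subseteq> A `` {w}"
        using w True step2[of _ w] adjD by (auto simp: Q_def)
      moreover have "card (insert q P) = 4" using ne finPQ cardP by simp
      ultimately show ?thesis
        using card_seteq[OF fin_nb, of "insert q P" w] deg_r[of w] w by simp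
    qed
    have eqP: "x v = x w" if "v \<in> P" "w \<in> P" for v w
    proof -
      have "v \<in> V" "w \<in> V" using that PV by auto
      then have "l * x v = l * x w"
        using eigen[of v] eigen[of w] nP[OF that(1)] nP[OF that(2)] by simp
      then show ?thesis using l_pos by simp
    qed
    have eqQ: "x v = x w" if "v \<in> Q" "w \<in> Q" for v w
    proof -
      have "v \<in> V" "w \<in> V" using that PV by auto
      then have "l * x v = l * x w"
        using eigen[of v] eigen[of w] nQ[OF that(1)] nQ[OF that(2)] by simp
      then show ?thesis using l_pos by simp
    qed
    obtain p1 p2 where p12: "p1 \<in> P" "p2 \<in> P" "p1 \<noteq> p2"
      using cardP by (auto simp: card_3_iff)
    obtain q1 q2 where q12: "q1 \<in> Q" "q2 \<in> Q" "q1 \<noteq> q2"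
      using cardQ by (auto simp: card_3_iff)
    \<comment> \<open>Now \<open>P\<close> and \<open>Q\<close> form a complete bipartite graph with
      constant entries on each side. One edge inside each side is inserted together with
      \<open>pq\<close>.\<close>
    let ?rs = "[(p, p1), (q, q1), (p2, q2)]" and ?ns = "[(p, q), (p1, p2), (q1, q2)]"
    have dist: "p \<noteq> q" "p1 \<noteq> p2" "q1 \<noteq> q2" "p1 \<noteq> q1" "p1 \<noteq> q2" "p2 \<noteq> q1" "p2 \<noteq> q2"
      "p \<noteq> p1" "p \<noteq> p2" "p \<noteq> q1" "p \<noteq> q2" "q \<noteq> p1" "q \<noteq> p2" "q \<noteq> q1" "q \<noteq> q2"
      using p12 q12 S ne True by auto
    have adj: "(p, p1) \<in> A" "(p, p2) \<in> A" "(q, q1) \<in> A" "(q, q2) \<in> A" "(p2, q2) \<in> A"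
      "(p2, q1) \<in> A" "(q2, p1) \<in> A" "(q2, q) \<in> A" "(q1, q) \<in> A" "(p2, p) \<in> A"
      "(q2, p2) \<in> A" "(q1, p2) \<in> A"
    proof -
      have "p1 \<in> A `` {p}" "p2 \<in> A `` {p}" "q1 \<in> A `` {q}" "q2 \<in> A `` {q}"
        "q2 \<in> A `` {p2}" "q1 \<in> A `` {p2}" "q2 \<in> A `` {p1}"
        using p12 q12 by (simp_all add: nP nbP nbQ)
      then show "(p, p1) \<in> A" "(p, p2) \<in> A" "(q, q1) \<in> A" "(q, q2) \<in> A" "(p2, q2) \<in> A"
        "(p2, q1) \<in> A" "(q2, p1) \<in> A" "(q2, q) \<in> A" "(q1, q) \<in> A" "(p2, p) \<in> A"
        "(q2, p2) \<in> A" "(q1, p2) \<in> A"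
        by (simp_all add: adjD)
    qed
    have nadj: "(p1, p2) \<notin> A" "(q1, q2) \<notin> A" "(p2, p1) \<notin> A" "(q2, q1) \<notin> A"
    proof -
      have "p2 \<notin> A `` {p1}" "q2 \<notin> A `` {q1}"
        using p12 q12 ne True by (auto simp: nP nQ)
      then show "(p1, p2) \<notin> A" "(q1, q2) \<notin> A" "(p2, p1) \<notin> A" "(q2, q1) \<notin> A"
        using adjD by blast+
    qed
    have V': "p1 \<in> V" "p2 \<in> V" "q1 \<in> V" "q2 \<in> V" using p12 q12 PV by auto
    have rs: "distinct (arcs_of ?rs)" "set ?rs \<subseteq> A" using dist adj by auto
    have ns: "distinct (arcs_of ?ns)" "set ?ns \<inter> A = {}" "set ?ns \<subseteq> V \<times> V"
      using dist nadj npq V V' by auto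
    have conn: "(a, b) \<in> (edit A ?rs ?ns)\<^sup>*" if "(a, b) \<in> set ?rs" for a b
    proof -
      have "(p, p1) \<in> (edit A ?rs ?ns)\<^sup>*" by (rule edit_path[of _ _ _ "[p2, p1]"]) (use dist adj in auto)
      moreover have "(q, q1) \<in> (edit A ?rs ?ns)\<^sup>*" by (rule edit_path[of _ _ _ "[q2, q1]"]) (use dist adj in auto)
      moreover have "(p2, q2) \<in> (edit A ?rs ?ns)\<^sup>*"
        by (rule edit_path[of _ _ _ "[p, q, q2]"]) (use dist adj in auto)
      ultimately show ?thesis using that by auto
    qed
    have adm': "admissible V (edit A ?rs ?ns)"
      by (rule admissible_edit_same_degrees[OF rs ns conn]) auto
    have "x p < x p1" "x p < x q1" "x q \<le> x p1" "x p1 = x p2" "x q1 = x q2"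
      using above[of p1] above[of q1] step1[of p1] eqP[of p1 p2] eqQ[of q1 q2] p12 q12 ne notS PV by auto
    moreover from this have "(x p1 - x q) * (x q1 - x p) + (x p1 - x q1)\<^sup>2 \<ge> 0"
      by (intro add_nonneg_nonneg mult_nonneg_nonneg) auto
    then have "quad_list ?rs x \<le> quad_list ?ns x"
      using \<open>x p1 = x p2\<close> \<open>x q1 = x q2\<close> by (simp add: algebra_simps power2_eq_square)
    then have "load ?ns x p1 = load ?rs x p1"
      using edit_eigen[OF rs ns(1,2) adm' _ V'(1)] by blast
    ultimately show False using dist by auto
  qed
qed

lemma nb_iff: "A `` {u} = N \<Longrightarrow> (u, y) \<in> A \<longleftrightarrow> y \<in> N" "A `` {u} = N \<Longrightarrow> (y, u) \<in> A \<longleftrightarrow> y \<in> N"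
  using adj_sym by blast+

lemma edit_contradiction:
  assumes rs: "distinct (arcs_of rs)" "set rs \<subseteq> A"
    and ns: "distinct (arcs_of ns)" "set ns \<inter> A = {}" "set ns \<subseteq> V \<times> V"
    and conn: "\<And>a b. (a, b) \<in> set rs \<Longrightarrow> (a, b) \<in> (edit A rs ns)\<^sup>*"
    and le: "\<And>v. v \<in> V \<Longrightarrow> deg A v + inc ns v \<le> 4 + inc rs v"
    and ex4: "\<exists>v\<in>V. deg A v + inc ns v = 4 + inc rs v"
    and ex_less: "\<exists>v\<in>V. deg A v + inc ns v < 4 + inc rs v"
    and T: "finite T" "T \<subseteq> V" "\<And>v. v \<notin> T \<Longrightarrow> z v = 0"
    and gain: "(\<Sum>s\<in>T. \<Sum>t\<in>T. if (s, t) \<in> A then z s * z t else 0) - l * (\<Sum>s\<in>T. (z s)\<^sup>2)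
      + 2 * quad_list ns (\<lambda>v. x v + z v) > 2 * quad_list rs (\<lambda>v. x v + z v)"
  shows False
  using edit_bound[OF rs ns(1,2) admissible_edit[OF rs ns conn le ex4 ex_less] T(1,2), of z] T(3) gain
  by simp

text \<open>When both cut edges start at \<open>s\<close>, the height conditions of
  \<open>two_cut\<close> are automatic: the minimum beyond the cut has a lower neighbour, which can
  only be \<open>s\<close>.\<close>

lemma two_cut_vertex:
  assumes S: "S \<subseteq> V" "s \<in> S" "p \<notin> S" "q \<notin> S" "p \<noteq> q" "(s, p) \<in> A" "(s, q) \<in> A"
    and cut: "\<And>a b. a \<in> S \<Longrightarrow> b \<notin> S \<Longrightarrow> (a, b) \<in> A \<Longrightarrow> a = s \<and> (b = p \<or> b = q)"
    and connS: "\<And>v. v \<in> S \<Longrightarrow> (s, v) \<in> (A \<inter> S \<times> S)\<^sup>*"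
    and deg4: "\<And>v. v \<in> V - S \<Longrightarrow> deg A v = 4"
    and big: "card (V - S) \<ge> 6"
  shows "(p, q) \<in> A"
proof -
  obtain m where m: "m \<in> V - S" "\<And>u. u \<in> V - S \<Longrightarrow> x m \<le> x u"
    using ex_minimizer[of "V - S"] big by (metis Diff_subset card.empty not_numeral_le_zero)
  obtain u where u: "(m, u) \<in> A" "x u < x m"
    using local_min[of m] m(1) deg4[of m] by auto
  then have "u \<in> S" using m(2)[of u] adj_inV by force
  then have "u = s" using cut[of u m] adjD[OF u(1)] m(1) by auto
  then have low: "x s < x p" "x s < x q" using u m(2)[of p] m(2)[of q] S adj_inV by force+
  have cut': "a = s \<and> b = p \<or> a = s \<and> b = q" "a = s \<and> b = q \<or> a = s \<and> b = p"
    if "a \<in> S" "b \<notin> S" "(a, b) \<in> A" for a b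
    using cut[OF that] by auto
  show ?thesis
  proof (cases "x p \<le> x q")
    case True
    show ?thesis
      by (rule two_cut[OF S(1,2,2-7) cut'(1) connS deg4 low(1,1) True big])
  next
    case False
    then have "x q \<le> x p" by simp
    have "(q, p) \<in> A"
      by (rule two_cut[OF S(1,2,2,4,3) S(5)[symmetric] S(7,6) cut'(2) connS deg4 low(2,2) \<open>x q \<le> x p\<close> big])
    then show ?thesis by (rule adjD)
  qed
qed

lemma card_Diff_ge_6: "card S \<le> 4 \<Longrightarrow> finite S \<Longrightarrow> card (V - S) \<ge> 6"
  using diff_card_le_card_Diff[of S V] card10 by linarith

section \<open>Local rewirings\<close>

text \<open>In the following lemmas the test vector solves, exactly or approximately, the eigenvalue
  equations of the rewired graph on the altered vertices.\<close>

lemma triangle_22_normalised: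
  assumes nb: "A `` {u} = {v, w}" "A `` {v} = {u, w}" "A `` {w} = {u, v, p, q}"
    and dist: "distinct [u, v, w, p, q]"
    and deg4: "\<And>r. r \<in> V - {u, v} \<Longrightarrow> deg A r = 4"
    and x1: "x u = 1"
  shows False
proof -
  note adj = nb[THEN nb_iff(1)] nb[THEN nb_iff(2)]
  note ne = dist[simplified] distinct_rev[THEN iffD2, OF dist, simplified]
  have V: "u \<in> V" "v \<in> V" "w \<in> V" "p \<in> V" "q \<in> V"
    using adj_inV[of u v] adj_inV[of w p] adj_inV[of w q] by (auto simp: adj)
  have degs: "deg A u = 2" "deg A v = 2" using nb dist by (auto simp: deg_def)
  have step: "(w, u) \<in> A \<inter> {u, v, w} \<times> {u, v, w}" "(w, v) \<in> A \<inter> {u, v, w} \<times> {u, v, w}"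
    by (auto simp: adj)
  have pq: "(p, q) \<in> A"
  proof (rule two_cut_vertex[of "{u, v, w}" w])
    show "card (V - {u, v, w}) \<ge> 6" using dist by (intro card_Diff_ge_6) auto
    show "(w, r) \<in> (A \<inter> {u, v, w} \<times> {u, v, w})\<^sup>*" if "r \<in> {u, v, w}" for r
      using that step by auto
  qed (use V dist deg4 in \<open>auto simp: adj\<close>)
  have e: "x v + x w = l" "1 + x w = l * x v" "1 + x v + x p + x q = l * x w"
    using eigen[of u] eigen[of v] eigen[of w] V dist by (simp_all add: nb x1)
  have "(x v - 1) * (l + 1) = 0" using e(1,2) by (simp add: algebra_simps)
  then have xv: "x v = 1" using l_pos by auto
  have xw: "x w = l - 1" using e xv by simp
  have s: "x p + x q = l\<^sup>2 - l - 2" using e(3) xv xw by (simp add: algebra_simps power2_eq_square)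
  \<comment> \<open>The new entries at \<open>u\<close>, \<open>v\<close>, \<open>w\<close> are
    \<open>2\<close>, \<open>l\<close>, \<open>l\<close>; with \<open>x p\<close> and
    \<open>x q\<close> kept they solve the equations of the rewired graph at these vertices
    exactly.\<close>
  define z where "z r = (if r = u then 1 else if r = v then l - 1 else if r = w then 1 else 0)" for r
  show False
  proof (rule edit_contradiction[of "[(p, q)]" "[(v, p), (v, q)]" "{u, v, w}" z])
    show "(a, b) \<in> (edit A [(p, q)] [(v, p), (v, q)])\<^sup>*" if "(a, b) \<in> set [(p, q)]" for a b
      by (rule edit_path[of _ _ _ "[v, q]"]) (use that in auto)
    show "deg A r + inc [(v, p), (v, q)] r \<le> 4 + inc [(p, q)] r" if "r \<in> V" for r
      using deg4[of r] that degs dist by (cases "r \<in> {u, v}") auto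
    show "\<exists>r\<in>V. deg A r + inc [(v, p), (v, q)] r = 4 + inc [(p, q)] r"
      using degs dist V by (intro bexI[of _ v]) auto
    show "\<exists>r\<in>V. deg A r + inc [(v, p), (v, q)] r < 4 + inc [(p, q)] r"
      using degs dist V by (intro bexI[of _ u]) auto
    \<comment> \<open>Only the sum of \<open>x p\<close> and \<open>x q\<close> is known. Bounding
      their product by the mean leaves half of \<open>(x p + x q) * ((4 - l) * (l + 1))\<close> as
      gain, which vanishes at \<open>l = 4\<close>.\<close>
    have "(x p - x q)\<^sup>2 \<ge> 0" by simp
    then have "4 * (x p * x q) \<le> (x p + x q)\<^sup>2" by (simp add: power2_eq_square algebra_simps)
    then have a: "4 * (x p * x q) \<le> (l\<^sup>2 - l - 2)\<^sup>2" unfolding s .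
    have "0 < x p + x q" using xpos V by (simp add: add_pos_pos)
    then have "0 < (x p + x q) * ((4 - l) * (l + 1))"
      using l_pos l_less_4 by (intro mult_pos_pos) auto
    then have "0 < (l\<^sup>2 - l - 2) * ((4 - l) * (l + 1))" unfolding s .
    then have "2 * (x p * x q) < 4 * l - 2 - l * (2 + (l - 1)\<^sup>2) + 2 * l * (l\<^sup>2 - l - 2)"
      using a by (simp add: power2_eq_square algebra_simps)
    then have "2 * (x p * x q) < 4 * l - 2 - l * (2 + (l - 1)\<^sup>2) + 2 * l * (x p + x q)" unfolding s .
    then show "2 * quad_list [(p, q)] (\<lambda>r. x r + z r) <
      (\<Sum>s\<in>{u, v, w}. \<Sum>t\<in>{u, v, w}. if (s, t) \<in> A then z s * z t else 0)
      - l * (\<Sum>s\<in>{u, v, w}. (z s)\<^sup>2) + 2 * quad_list [(v, p), (v, q)] (\<lambda>r. x r + z r)"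
      by (simp add: z_def adj xv xw x1 ne algebra_simps power2_eq_square)
  qed (use V dist pq in \<open>auto simp: adj z_def\<close>)
qed

text \<open>Minimum principle: the strictly lower neighbour that \<open>local_min\<close> gives to a
  minimum outside \<open>D\<close> must lie in \<open>D\<close>.\<close>

lemma ex_low_boundary:
  assumes deg4: "\<And>r. r \<in> V - D \<Longrightarrow> deg A r = 4" and ne: "V - D \<noteq> {}"
  obtains m d where "m \<in> V - D" "d \<in> D" "(d, m) \<in> A" "x d < x m" "\<And>r. r \<in> V - D \<Longrightarrow> x m \<le> x r"
proof -
  obtain m where m: "m \<in> V - D" "\<And>u. u \<in> V - D \<Longrightarrow> x m \<le> x u"
    using ex_minimizer[of "V - D"] ne by blast
  obtain u where u: "(m, u) \<in> A" "x u < x m"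
    using local_min[of m] m(1) deg4[of m] by auto
  then have "u \<in> D" using m(2)[of u] adj_inV by force
  then show ?thesis using that m u adjD by blast
qed

lemma above_const:
  assumes deg4: "\<And>r. r \<in> V - D \<Longrightarrow> deg A r = 4" and c: "\<And>d. d \<in> D \<Longrightarrow> c \<le> x d"
    and r: "r \<in> V - D"
  shows "c < x r"
proof -
  obtain m d where "d \<in> D" "x d < x m" "x m \<le> x r"
    using ex_low_boundary[OF deg4] r by blast
  then show ?thesis using c[of d] by simp
qed

lemma triangle_233_normalised:
  assumes nb: "A `` {u} = {v, w}" "A `` {v} = {u, w, z}" "A `` {w} = {u, v, z}"
      "A `` {z} = {v, w, p, q}"
    and dist: "distinct [u, v, w, z, p, q]"
    and deg4: "\<And>r. r \<in> V - {u, v, w} \<Longrightarrow> deg A r = 4"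
    and x1: "x u = 1"
  shows False
proof -
  note adj = nb[THEN nb_iff(1)] nb[THEN nb_iff(2)]
  note ne = dist[simplified] distinct_rev[THEN iffD2, OF dist, simplified]
  have V: "u \<in> V" "v \<in> V" "w \<in> V" "z \<in> V" "p \<in> V" "q \<in> V"
    using adj_inV[of u v] adj_inV[of w z] adj_inV[of z p] adj_inV[of z q] by (auto simp: adj)
  have degs: "deg A u = 2" "deg A v = 3" "deg A w = 3" using nb ne by (auto simp: deg_def)
  let ?S = "{u, v, w, z}"
  have step: "(z, v) \<in> A \<inter> ?S \<times> ?S" "(z, w) \<in> A \<inter> ?S \<times> ?S" "(v, u) \<in> A \<inter> ?S \<times> ?S"
    by (auto simp: adj)
  have pq: "(p, q) \<in> A"
  proof (rule two_cut_vertex[of ?S z])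
    show "card (V - ?S) \<ge> 6" using ne by (intro card_Diff_ge_6) auto
    have "(z, u) \<in> (A \<inter> ?S \<times> ?S)\<^sup>*" using step(1,3) by (meson r_into_rtrancl rtrancl.rtrancl_into_rtrancl)
    then show "(z, r) \<in> (A \<inter> ?S \<times> ?S)\<^sup>*" if "r \<in> ?S" for r
      using that step by auto
  qed (use V ne deg4 in \<open>auto simp: adj\<close>)
  have e: "x v + x w = l" "1 + x w + x z = l * x v" "1 + x v + x z = l * x w"
     "x v + x w + x p + x q = l * x z"
    using eigen[of u] eigen[of v] eigen[of w] eigen[of z] V by (simp_all add: nb x1 ne)
  have "(x v - x w) * (l + 1) = 0" using e(2,3) by (simp add: algebra_simps)
  then have xvw: "x v = x w" using l_pos by auto
  have xw: "x w = l / 2" "x v = l / 2" using e(1) xvw by auto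
  have xz: "x z = (l\<^sup>2 - l - 2) / 2" using e(2) xw by (simp add: field_simps power2_eq_square)
  have s: "x p + x q = l * (l\<^sup>2 - l - 4) / 2" using e(4) xw xz by (simp add: field_simps power2_eq_square)
  \<comment> \<open>The new entries \<open>(l + 2) / 2\<close> at \<open>u\<close>,
    \<open>l * (l + 2) / 4\<close> at \<open>v\<close> and \<open>w\<close>, and
    \<open>(l^2 - 2) / 2\<close> at \<open>z\<close> solve the new equations when \<open>x p\<close>
    and \<open>x q\<close> are replaced by their mean.\<close>
  define y where "y r = (if r = u then l / 2 else if r = v then l\<^sup>2 / 4 else if r = w then l\<^sup>2 / 4
    else if r = z then l / 2 else 0)" for r
  show False
  proof (rule edit_contradiction[of "[(p, q)]" "[(v, p), (w, q)]" "{u, v, w, z}" y])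
    show "(a, b) \<in> (edit A [(p, q)] [(v, p), (w, q)])\<^sup>*" if "(a, b) \<in> set [(p, q)]" for a b
      by (rule edit_path[of _ _ _ "[v, w, q]"]) (use that ne in \<open>auto simp: adj\<close>)
    show "deg A r + inc [(v, p), (w, q)] r \<le> 4 + inc [(p, q)] r" if "r \<in> V" for r
      using deg4[of r] that degs ne by (cases "r \<in> {u, v, w}") auto
    show "\<exists>r\<in>V. deg A r + inc [(v, p), (w, q)] r = 4 + inc [(p, q)] r"
      using degs ne V by (intro bexI[of _ v]) auto
    show "\<exists>r\<in>V. deg A r + inc [(v, p), (w, q)] r < 4 + inc [(p, q)] r"
      using degs ne V by (intro bexI[of _ u]) auto
    have "(x p - x q)\<^sup>2 \<ge> 0" by simp
    then have "4 * (x p * x q) \<le> (x p + x q)\<^sup>2" by (simp add: power2_eq_square algebra_simps)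
    then have a: "4 * (x p * x q) \<le> (l * (l\<^sup>2 - l - 4) / 2)\<^sup>2" unfolding s .
    have "0 < x p + x q" using xpos V by (simp add: add_pos_pos)
    then have "0 < (x p + x q) * (l * (4 - l) * (l + 2))"
      using l_pos l_less_4 by (intro mult_pos_pos) auto
    then have "0 < (l * (l\<^sup>2 - l - 4) / 2) * (l * (4 - l) * (l + 2))" unfolding s .
    then have "2 * (x p * x q) < l ^ 3 / 2 + l ^ 4 / 8 - l ^ 5 / 8
        + l * (l + 2) / 2 * (l * (l\<^sup>2 - l - 4) / 2)"
      using a by (simp add: eval_nat_numeral field_simps)
    then have "2 * (x p * x q) < l ^ 3 / 2 + l ^ 4 / 8 - l ^ 5 / 8 + l * (l + 2) / 2 * (x p + x q)"
      unfolding s .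
    then show "2 * quad_list [(p, q)] (\<lambda>r. x r + y r) <
      (\<Sum>s\<in>{u, v, w, z}. \<Sum>t\<in>{u, v, w, z}. if (s, t) \<in> A then y s * y t else 0)
      - l * (\<Sum>s\<in>{u, v, w, z}. (y s)\<^sup>2) + 2 * quad_list [(v, p), (w, q)] (\<lambda>r. x r + y r)"
      by (simp add: y_def adj xw xz x1 ne eval_nat_numeral field_simps)
  qed (use V ne pq in \<open>auto simp: adj y_def\<close>)
qed

lemma pendant_normalised:
  assumes nb: "A `` {u} = {v}" "A `` {v} = {u, p, q}" "A `` {p} = {v, q, p1, p2}"
    and dist: "distinct [u, v, p, q, p1, p2]"
    and deg4: "\<And>r. r \<in> V - {u, v} \<Longrightarrow> deg A r = 4"
    and x1: "x u = 1" and le: "x p \<le> x q"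
  shows False
proof -
  note adj = nb[THEN nb_iff(1)] nb[THEN nb_iff(2)]
  note ne = dist[simplified] distinct_rev[THEN iffD2, OF dist, simplified]
  have V: "u \<in> V" "v \<in> V" "p \<in> V" "q \<in> V" "p1 \<in> V" "p2 \<in> V"
    using adj_inV[of u v] adj_inV[of v p] adj_inV[of v q] adj_inV[of p p1] adj_inV[of p p2]
    by (auto simp: adj)
  have degs: "deg A u = 1" "deg A v = 3" using nb ne by (auto simp: deg_def)
  have l: "18 / 5 \<le> l" by (rule l_ge[of "{u, v}"]) (use V deg4 degs ne in auto)
  have e: "x v = l" "1 + x p + x q = l * x v" "x v + x q + x p1 + x p2 = l * x p"
    using eigen[of u] eigen[of v] eigen[of p] V by (simp_all add: nb x1 ne)
  have above: "x p \<le> x r" if r: "r \<in> V - {u, v}" for r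
  proof -
    obtain m d where "m \<in> V - {u, v}" "d \<in> {u, v}" "(d, m) \<in> A" "x d < x m"
      and "\<And>r. r \<in> V - {u, v} \<Longrightarrow> x m \<le> x r"
      by (rule ex_low_boundary[of "{u, v}", OF deg4]) (use r in auto)
    moreover from this have "x m \<le> x r" using r by auto
    ultimately have "m \<in> V - {u, v}" "d \<in> {u, v}" "(d, m) \<in> A" "x m \<le> x r" by auto
    then show ?thesis using le by (auto simp: adj)
  qed
  have P: "2 * x p \<le> x p1 + x p2"
    using above[of p1] above[of p2] V ne by auto
  define e where "e = 4 - l"
  \<comment> \<open>The equation at \<open>v\<close> fixes \<open>x p + x q = l^2 - 1\<close>, so
    \<open>d\<close> is the one free parameter.\<close>
  define d where "d = (x q - x p) / 2"
  have e_bds: "0 < e" "e \<le> 2 / 5" using l l_less_4 by (auto simp: e_def)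
  have l_eq: "l = 4 - e" by (simp add: e_def)
  have xp: "x p = (l\<^sup>2 - 1) / 2 - d" and xq: "x q = (l\<^sup>2 - 1) / 2 + d"
    using \<open>x v = l\<close> \<open>1 + x p + x q = l * x v\<close> by (simp_all add: d_def field_simps power2_eq_square)
  have d0: "d \<ge> 0" using le by (simp add: d_def)
  \<comment> \<open>Since \<open>p1\<close> and \<open>p2\<close> are not lower than
    \<open>p\<close>, the equation at \<open>p\<close> limits how far \<open>q\<close> rises above
    \<open>p\<close>. \<open>6 / 5\<close> is a round value above the limit \<open>7 / 6\<close>
    obtained at \<open>l = 4\<close>.\<close>
  have d1: "d \<le> 6 / 5"
  proof -
    have "l * x p - l - x q \<ge> 2 * x p" using P e by simp
    then have "(l - 1) * d \<le> (l - 1) * (l\<^sup>2 - 1) / 2 - (l\<^sup>2 + l - 1)"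
      unfolding xp xq by (simp add: field_simps)
    also have "\<dots> \<le> (l - 1) * (6 / 5)"
    proof -
      have "e ^ 2 \<le> e * (2 / 5)" unfolding power2_eq_square using e_bds by (intro mult_left_mono) auto
      moreover have "0 \<le> e ^ 3" using e_bds by simp
      ultimately have "0 \<le> 1 + 93 * e - 45 * e ^ 2 + 5 * e ^ 3"
        using e_bds by linarith
      then have "0 \<le> (1 + 93 * e - 45 * e ^ 2 + 5 * e ^ 3) / 10" by simp
      also have "\<dots> = (l - 1) * (6 / 5) - ((l - 1) * (l\<^sup>2 - 1) / 2 - (l\<^sup>2 + l - 1))"
        unfolding l_eq by (simp add: field_simps eval_nat_numeral)
      finally show ?thesis by simp
    qed
    finally show ?thesis using l by (subst (asm) mult_le_cancel_left_pos) auto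
  qed
  \<comment> \<open>\<open>F d\<close> is the gain of the rewiring; \<open>F\<close> is concave, so it suffices to check the ends of
    \<open>[0, 6/5]\<close>.\<close>
  define F where "F t = 2 * ((3 * l / 4 - 11 / 20) * (3 * l / 4) + (3 * l / 4) * (7 * l / 4 - (l\<^sup>2 - 1) / 2 + t)
      + (3 * l / 4) * (3 / 5 - 3 / 10 * t) + (7 * l / 4 - (l\<^sup>2 - 1) / 2 + t) * (3 / 5 - 3 / 10 * t))
    - l * ((3 * l / 4 - 11 / 20)\<^sup>2 + (3 * l / 4)\<^sup>2 + (7 * l / 4 - (l\<^sup>2 - 1) / 2 + t)\<^sup>2 + (3 / 5 - 3 / 10 * t)\<^sup>2)
    + 2 * (3 * l / 4 + 9 / 20) * (7 * l / 4)" for t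
  have "F d > 0"
  proof -
    have "e\<^sup>2 \<le> e * (2 / 5)" unfolding power2_eq_square using e_bds by (intro mult_left_mono) auto
    moreover have "e ^ 4 \<le> e ^ 3 * (2 / 5)"
    proof -
      have "e ^ 3 * e \<le> e ^ 3 * (2 / 5)" using e_bds by (intro mult_left_mono) auto
      then show ?thesis by (simp add: eval_nat_numeral mult.assoc)
    qed
    moreover have "0 \<le> e ^ 3" "0 \<le> e ^ 5" using e_bds by auto
    moreover have "F 0 = 11 / 20 + 3409 / 80 * e - 202 / 5 * e\<^sup>2 + 263 / 16 * e ^ 3 - 13 / 4 * e ^ 4 + e ^ 5 / 4"
      unfolding F_def l_eq by (simp add: field_simps eval_nat_numeral)
    moreover have "F (6 / 5) = 16939 / 2500 + 180701 / 10000 * e - 746 / 25 * e\<^sup>2 + 1219 / 80 * e ^ 3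
        - 13 / 4 * e ^ 4 + e ^ 5 / 4"
      unfolding F_def l_eq by (simp add: field_simps eval_nat_numeral)
    ultimately have "F 0 > 0" "F (6 / 5) > 0" using e_bds by linarith+
    \<comment> \<open>Interpolation of a quadratic between 0 and \<open>6 / 5\<close>;
      \<open>3 / 5 + 109 / 100 * l\<close> is the negated leading coefficient of
      \<open>F\<close>.\<close>
    moreover have "F d = (1 - 5 / 6 * d) * F 0 + 5 / 6 * d * F (6 / 5) + (3 / 5 + 109 / 100 * l) * (d * (6 / 5 - d))"
      unfolding F_def by (simp add: field_simps power2_eq_square)
    moreover have "(3 / 5 + 109 / 100 * l) * (d * (6 / 5 - d)) \<ge> 0"
      using d0 d1 l_pos by (intro mult_nonneg_nonneg) auto
    moreover have "(1 - 5 / 6 * d) * F 0 + 5 / 6 * d * F (6 / 5) > 0"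
    proof (cases "d = 0")
      case False
      then show ?thesis using calculation(1,2) d0 d1
        by (intro add_nonneg_pos mult_nonneg_nonneg mult_pos_pos) auto
    qed (use calculation(1) in simp)
    ultimately show ?thesis by linarith
  qed
  \<comment> \<open>\<open>v\<close> and \<open>p\<close> both receive \<open>7 * l / 4\<close>, so
    exchanging \<open>p p1\<close> for \<open>v p1\<close> costs nothing and \<open>x p1\<close>
    drops out. The entries at \<open>u\<close> and \<open>q\<close> are approximations.\<close>
  define z where "z r = (if r = u then 3 * l / 4 - 11 / 20 else if r = v then 3 * l / 4
    else if r = p then 7 * l / 4 - x p else if r = q then 3 / 5 - 3 / 10 * d else 0)" for r
  have zp: "7 * l / 4 - x p = 7 * l / 4 - (l\<^sup>2 - 1) / 2 + d" using xp by simp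
  have pq: "(p, q) \<in> A" by (simp add: adj)
  show False
  proof (rule edit_contradiction[of "[(p, p1)]" "[(u, p), (v, p1)]" "{u, v, p, q}" z])
    show "(a, b) \<in> (edit A [(p, p1)] [(u, p), (v, p1)])\<^sup>*" if "(a, b) \<in> set [(p, p1)]" for a b
      by (rule edit_path[of _ _ _ "[v, p1]"]) (use that ne in \<open>auto simp: adj\<close>)
    show "deg A r + inc [(u, p), (v, p1)] r \<le> 4 + inc [(p, p1)] r" if "r \<in> V" for r
      using deg4[of r] that degs ne by (cases "r \<in> {u, v}") auto
    show "\<exists>r\<in>V. deg A r + inc [(u, p), (v, p1)] r = 4 + inc [(p, p1)] r"
      using degs ne V by (intro bexI[of _ v]) auto
    show "\<exists>r\<in>V. deg A r + inc [(u, p), (v, p1)] r < 4 + inc [(p, p1)] r"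
      using degs ne V by (intro bexI[of _ u]) auto
    have "(\<Sum>s\<in>{u, v, p, q}. \<Sum>t\<in>{u, v, p, q}. if (s, t) \<in> A then z s * z t else 0)
      - l * (\<Sum>s\<in>{u, v, p, q}. (z s)\<^sup>2) + 2 * quad_list [(u, p), (v, p1)] (\<lambda>r. x r + z r)
      - 2 * quad_list [(p, p1)] (\<lambda>r. x r + z r) = F d"
      unfolding F_def zp[symmetric]
      by (simp add: z_def adj x1 \<open>x v = l\<close> ne power2_eq_square algebra_simps) (simp add: field_simps)
    then show "2 * quad_list [(p, p1)] (\<lambda>r. x r + z r) <
      (\<Sum>s\<in>{u, v, p, q}. \<Sum>t\<in>{u, v, p, q}. if (s, t) \<in> A then z s * z t else 0)
      - l * (\<Sum>s\<in>{u, v, p, q}. (z s)\<^sup>2) + 2 * quad_list [(u, p), (v, p1)] (\<lambda>r. x r + z r)"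
      using \<open>F d > 0\<close> by linarith
  qed (use V ne pq in \<open>auto simp: adj z_def\<close>)
qed

text \<open>Equal neighbourhoods give \<open>u\<close> and \<open>v\<close> equal entries, lower
  than all others, so both factors of the switch gain are negative.\<close>

lemma nonadjacent_twins:
  assumes nb: "A `` {u} = {a, b, c}" "A `` {v} = {a, b, c}"
    and dist: "distinct [u, v, a, b, c]"
    and ab: "(a, b) \<notin> A"
    and deg4: "\<And>r. r \<in> V - {u, v} \<Longrightarrow> deg A r = 4"
  shows False
proof -
  note adj = nb[THEN nb_iff(1)] nb[THEN nb_iff(2)]
  note ne = dist[simplified] distinct_rev[THEN iffD2, OF dist, simplified]
  have V: "u \<in> V" "v \<in> V" "a \<in> V" "b \<in> V"
    using adj_inV[of u a] adj_inV[of v b] by (auto simp: adj)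
  have "l * x u = l * x v" using eigen[of u] eigen[of v] V nb by simp
  then have xuv: "x v = x u" using l_pos by simp
  have "x u < x r" if "r \<in> V - {u, v}" for r
    by (rule above_const[of "{u, v}"]) (use deg4 that xuv in auto)
  then have above: "x u < x a" "x u < x b" using V ne by auto
  show False
  proof (rule switch[of u a v b])
    show "(u, a) \<in> (edit A [(u, a), (v, b)] [(u, v), (a, b)])\<^sup>*"
      by (rule edit_path[of _ _ _ "[v, a]"]) (use ne in \<open>auto simp: adj\<close>)
    show "(v, b) \<in> (edit A [(u, a), (v, b)] [(u, v), (a, b)])\<^sup>*"
      by (rule edit_path[of _ _ _ "[u, b]"]) (use ne in \<open>auto simp: adj\<close>)
    show "0 \<le> (x u - x b) * (x v - x a)"
      using above xuv by (intro mult_nonpos_nonpos) auto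
  qed (use ab above xuv ne in \<open>auto simp: adj\<close>)
qed

lemma adjacent_twins_nonadjacent_nbs_normalised:
  assumes nb: "A `` {u} = {v, a, b}" "A `` {v} = {u, a, b}"
    and a1: "(a, a1) \<in> A" and ab: "(a, b) \<notin> A"
    and dist: "distinct [u, v, a, b, a1]"
    and deg4: "\<And>r. r \<in> V - {u, v} \<Longrightarrow> deg A r = 4"
    and x1: "x u = 1" and le: "x a \<le> x b"
  shows False
proof -
  note adj = nb[THEN nb_iff(1)] nb[THEN nb_iff(2)]
  note ne = dist[simplified] distinct_rev[THEN iffD2, OF dist, simplified]
  have V: "u \<in> V" "v \<in> V" "a \<in> V" "b \<in> V" "a1 \<in> V"
    using adj_inV[of u a] adj_inV[of v b] adj_inV[OF a1] by (auto simp: adj)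
  have degs: "deg A u = 3" "deg A v = 3" using nb ne by (auto simp: deg_def)
  have l: "18 / 5 \<le> l" by (rule l_ge[of "{u, v}"]) (use V deg4 degs ne in auto)
  have e: "x v + x a + x b = l" "1 + x a + x b = l * x v"
    using eigen[of u] eigen[of v] V by (simp_all add: nb x1 ne)
  have "(x v - 1) * (l + 1) = 0" using e by (simp add: algebra_simps)
  then have xv: "x v = 1" using l_pos by auto
  have xb: "x b = l - 1 - x a" using e xv by simp
  have "1 < x a" by (rule above_const[of "{u, v}"]) (use deg4 V ne xv x1 in auto)
  have xa2: "x a \<le> (l - 1) / 2" using le xb by simp
  \<comment> \<open>\<open>v\<close> and \<open>a\<close> both get the entry \<open>3 / 2\<close>,
    which eliminates \<open>x a1\<close>.\<close>
  define z where "z r = (if r = v then 1 / 2 else if r = a then 3 / 2 - x a else 0)" for r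
  show False
  proof (rule edit_contradiction[of "[(u, b), (a, a1)]" "[(a, b), (v, a1)]" "{v, a}" z])
    show "(c, d) \<in> (edit A [(u, b), (a, a1)] [(a, b), (v, a1)])\<^sup>*"
      if "(c, d) \<in> set [(u, b), (a, a1)]" for c d
    proof -
      have "(u, b) \<in> (edit A [(u, b), (a, a1)] [(a, b), (v, a1)])\<^sup>*"
        by (rule edit_path[of _ _ _ "[v, b]"]) (use ne in \<open>auto simp: adj\<close>)
      moreover have "(a, a1) \<in> (edit A [(u, b), (a, a1)] [(a, b), (v, a1)])\<^sup>*"
        by (rule edit_path[of _ _ _ "[v, a1]"]) (use ne in \<open>auto simp: adj\<close>)
      ultimately show ?thesis using that by auto
    qed
    show "deg A r + inc [(a, b), (v, a1)] r \<le> 4 + inc [(u, b), (a, a1)] r" if "r \<in> V" for r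
      using deg4[of r] that degs ne by (cases "r \<in> {u, v}") auto
    show "\<exists>r\<in>V. deg A r + inc [(a, b), (v, a1)] r = 4 + inc [(u, b), (a, a1)] r"
      using degs ne V by (intro bexI[of _ v]) auto
    show "\<exists>r\<in>V. deg A r + inc [(a, b), (v, a1)] r < 4 + inc [(u, b), (a, a1)] r"
      using degs ne V by (intro bexI[of _ u]) auto
    \<comment> \<open>The gain is a concave quadratic in \<open>x a\<close>: a product vanishing at
      the ends 1 and \<open>(l - 1) / 2\<close> of its range, plus a positive affine part.\<close>
    have "1 / 2 - 2 * x a + 3 / 4 * l - l * (3 / 2 - x a)\<^sup>2 > 0"
    proof -
      have "0 \<le> l * (((l - 1) / 2 - x a) * (x a - 1))"
        using \<open>1 < x a\<close> xa2 l_pos by (intro mult_nonneg_nonneg) auto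
      moreover have "0 \<le> (x a - 1) * ((l - 1) * (4 - l)) / 2"
        using \<open>1 < x a\<close> l l_less_4 by (intro mult_nonneg_nonneg divide_nonneg_pos) auto
      ultimately have "0 < l * (((l - 1) / 2 - x a) * (x a - 1)) + (x a - 1) * ((l - 1) * (4 - l)) / 2 + (l - 3) / 2"
        using l by (intro add_nonneg_pos add_nonneg_nonneg) auto
      also have "\<dots> = 1 / 2 - 2 * x a + 3 / 4 * l - l * (3 / 2 - x a)\<^sup>2"
        by (simp add: field_simps power2_eq_square)
      finally show ?thesis .
    qed
    then show "2 * quad_list [(u, b), (a, a1)] (\<lambda>r. x r + z r) <
      (\<Sum>s\<in>{v, a}. \<Sum>t\<in>{v, a}. if (s, t) \<in> A then z s * z t else 0)
      - l * (\<Sum>s\<in>{v, a}. (z s)\<^sup>2) + 2 * quad_list [(a, b), (v, a1)] (\<lambda>r. x r + z r)"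
      by (simp add: z_def adj xv xb x1 ne power2_eq_square field_simps)
  qed (use V ne ab a1 adjD[OF a1] in \<open>auto simp: adj z_def adj_sym[of b a]\<close>)
qed

lemma adjacent_twins_common_nb_normalised:
  assumes nb: "A `` {u} = {v, a, b}" "A `` {v} = {u, a, b}" "A `` {a} = {u, v, b, z}"
      "A `` {b} = {u, v, a, z}" "A `` {z} = {a, b, p, q}"
    and dist: "distinct [u, v, a, b, z, p, q]"
    and deg4: "\<And>r. r \<in> V - {u, v} \<Longrightarrow> deg A r = 4"
    and x1: "x u = 1"
  shows False
proof -
  note adj = nb[THEN nb_iff(1)] nb[THEN nb_iff(2)]
  note ne = dist[simplified] distinct_rev[THEN iffD2, OF dist, simplified]
  have V: "u \<in> V" "v \<in> V" "a \<in> V" "b \<in> V" "z \<in> V" "p \<in> V" "q \<in> V"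
    using adj_inV[of u a] adj_inV[of v b] adj_inV[of z p] adj_inV[of z q] by (auto simp: adj)
  have degs: "deg A u = 3" "deg A v = 3" using nb ne by (auto simp: deg_def)
  have l: "18 / 5 \<le> l" by (rule l_ge[of "{u, v}"]) (use V deg4 degs ne in auto)
  have e: "x v + x a + x b = l" "1 + x a + x b = l * x v" "1 + x v + x b + x z = l * x a"
      "1 + x v + x a + x z = l * x b" "x a + x b + x p + x q = l * x z"
    using eigen[of u] eigen[of v] eigen[of a] eigen[of b] eigen[of z] V by (simp_all add: nb x1 ne)
  have "(x v - 1) * (l + 1) = 0" using e(1,2) by (simp add: algebra_simps)
  then have xv: "x v = 1" using l_pos by auto
  have "(x a - x b) * (l + 1) = 0" using e(3,4) by (simp add: algebra_simps)
  then have "x a = x b" using l_pos by auto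
  then have xa: "x a = (l - 1) / 2" "x b = (l - 1) / 2" using e(1) xv by auto
  have xz: "x z = (l\<^sup>2 - 2 * l - 3) / 2" using e(3) xa xv by (simp add: field_simps power2_eq_square)
  \<comment> \<open>The new entries are \<open>(l^2 - l - 2) / 4\<close> at both \<open>v\<close>
    and \<open>z\<close>, which cancels \<open>x q\<close>, and \<open>l / 2\<close> at
    \<open>a\<close> and \<open>b\<close>. With \<open>x u = 1\<close> they solve the new equations
    up to replacing \<open>x p\<close>, \<open>x q\<close> by their mean.\<close>
  define y where "y r = (if r = v then (l\<^sup>2 - l - 6) / 4 else if r = a then 1 / 2
    else if r = b then 1 / 2 else if r = z then (4 + 3 * l - l\<^sup>2) / 4 else 0)" for r
  show False
  proof (rule edit_contradiction[of "[(u, v), (z, q)]" "[(v, z), (v, q)]" "{v, a, b, z}" y])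
    show "(c, d) \<in> (edit A [(u, v), (z, q)] [(v, z), (v, q)])\<^sup>*"
      if "(c, d) \<in> set [(u, v), (z, q)]" for c d
    proof -
      have "(u, v) \<in> (edit A [(u, v), (z, q)] [(v, z), (v, q)])\<^sup>*"
        by (rule edit_path[of _ _ _ "[a, v]"]) (use ne in \<open>auto simp: adj\<close>)
      moreover have "(z, q) \<in> (edit A [(u, v), (z, q)] [(v, z), (v, q)])\<^sup>*"
        by (rule edit_path[of _ _ _ "[v, q]"]) (use ne in \<open>auto simp: adj\<close>)
      ultimately show ?thesis using that by auto
    qed
    show "deg A r + inc [(v, z), (v, q)] r \<le> 4 + inc [(u, v), (z, q)] r" if "r \<in> V" for r
      using deg4[of r] that degs ne by (cases "r \<in> {u, v}") auto
    show "\<exists>r\<in>V. deg A r + inc [(v, z), (v, q)] r = 4 + inc [(u, v), (z, q)] r"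
      using degs ne V by (intro bexI[of _ v]) auto
    show "\<exists>r\<in>V. deg A r + inc [(v, z), (v, q)] r < 4 + inc [(u, v), (z, q)] r"
      using degs ne V by (intro bexI[of _ u]) auto
    define e where "e = 4 - l"
    have e_bds: "0 < e" "e \<le> 2 / 5" using l l_less_4 by (auto simp: e_def)
    have l_eq: "l = 4 - e" by (simp add: e_def)
    \<comment> \<open>The gain vanishes at \<open>l = 4\<close>; the bracket is positive because
      \<open>149 / 8 * e\<close> is at most 7.45 for \<open>e \<le> 2 / 5\<close>.\<close>
    have "e * (35 / 4 - 149 / 8 * e + e\<^sup>2 * (77 / 8 - 15 / 8 * e) + e ^ 4 / 8) > 0"
      using e_bds by (intro mult_pos_pos add_pos_nonneg mult_nonneg_nonneg) auto
    moreover have "(\<Sum>s\<in>{v, a, b, z}. \<Sum>t\<in>{v, a, b, z}. if (s, t) \<in> A then y s * y t else 0)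
      - l * (\<Sum>s\<in>{v, a, b, z}. (y s)\<^sup>2) + 2 * quad_list [(v, z), (v, q)] (\<lambda>r. x r + y r)
      - 2 * quad_list [(u, v), (z, q)] (\<lambda>r. x r + y r)
      = e * (35 / 4 - 149 / 8 * e + e\<^sup>2 * (77 / 8 - 15 / 8 * e) + e ^ 4 / 8)"
      by (simp add: y_def adj xv xa xz x1 ne l_eq) (simp add: field_simps eval_nat_numeral)
    ultimately show "2 * quad_list [(u, v), (z, q)] (\<lambda>r. x r + y r) <
      (\<Sum>s\<in>{v, a, b, z}. \<Sum>t\<in>{v, a, b, z}. if (s, t) \<in> A then y s * y t else 0)
      - l * (\<Sum>s\<in>{v, a, b, z}. (y s)\<^sup>2) + 2 * quad_list [(v, z), (v, q)] (\<lambda>r. x r + y r)"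
      by linarith
  qed (use V ne in \<open>auto simp: adj y_def\<close>)
qed

lemma adjacent_twins_two_cut_normalised:
  assumes nb: "A `` {u} = {v, a, b}" "A `` {v} = {u, a, b}" "A `` {a} = {u, v, b, p}"
      "A `` {b} = {u, v, a, q}"
    and dist: "distinct [u, v, a, b, p, q]"
    and deg4: "\<And>r. r \<in> V - {u, v} \<Longrightarrow> deg A r = 4"
    and x1: "x u = 1" and le: "x a \<le> x b"
  shows False
proof -
  note adj = nb[THEN nb_iff(1)] nb[THEN nb_iff(2)]
  note ne = dist[simplified] distinct_rev[THEN iffD2, OF dist, simplified]
  have V: "u \<in> V" "v \<in> V" "a \<in> V" "b \<in> V" "p \<in> V" "q \<in> V"
    using adj_inV[of u a] adj_inV[of v b] adj_inV[of a p] adj_inV[of b q] by (auto simp: adj)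
  have degs: "deg A u = 3" "deg A v = 3" using nb ne by (auto simp: deg_def)
  have l: "18 / 5 \<le> l" by (rule l_ge[of "{u, v}"]) (use V deg4 degs ne in auto)
  have e: "x v + x a + x b = l" "1 + x a + x b = l * x v" "1 + x v + x b + x p = l * x a"
      "1 + x v + x a + x q = l * x b"
    using eigen[of u] eigen[of v] eigen[of a] eigen[of b] V by (simp_all add: nb x1 ne)
  have "(x v - 1) * (l + 1) = 0" using e(1,2) by (simp add: algebra_simps)
  then have xv: "x v = 1" using l_pos by auto
  have above: "1 < x r" if "r \<in> V - {u, v}" for r
    by (rule above_const[of "{u, v}"]) (use deg4 that x1 xv in auto)
  have "x q - x p = (l + 1) * (x b - x a)" using e(3,4) by (simp add: algebra_simps)
  moreover from this have eq: "x a = x b" if "x p = x q"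
    using that l_pos by simp
  moreover have "0 \<le> (l + 1) * (x b - x a)" using le l_pos by (intro mult_nonneg_nonneg) auto
  ultimately have xpq: "x p \<le> x q" by linarith
  \<comment> \<open>If the minimum beyond the four vertices is attained at \<open>q\<close>, then
    \<open>x p = x q\<close>, and the equations at \<open>a\<close> and \<open>b\<close> give
    \<open>x a = x b\<close>.\<close>
  have xap: "x a < x p"
  proof -
    obtain m d where "m \<in> V - {u, v, a, b}" "d \<in> {u, v, a, b}" "(d, m) \<in> A" "x d < x m"
      and min: "\<And>r. r \<in> V - {u, v, a, b} \<Longrightarrow> x m \<le> x r"
      by (rule ex_low_boundary[of "{u, v, a, b}", OF deg4]) (use V ne in auto)
    then have "m = p \<and> d = a \<or> m = q \<and> d = b" by (auto simp: adj)
    moreover have "x m \<le> x p" using min V ne by auto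
    ultimately show ?thesis using \<open>x d < x m\<close> xpq eq by auto
  qed
  \<comment> \<open>Otherwise replacing \<open>ub\<close>, \<open>pr\<close> by \<open>up\<close>,
    \<open>br\<close> for a further neighbour \<open>r\<close> of \<open>p\<close> changes the form
    by twice \<open>(x u - x r) * (x p - x b) \<ge> 0\<close>, and \<open>x u < x r\<close>.\<close>
  have xbp: "x b < x p"
  proof (rule ccontr)
    assume "\<not> ?thesis"
    then have "x p \<le> x b" by simp
    have "card (A `` {p}) = 4" using deg4[of p] V ne by (simp add: deg_def)
    then have "\<not> A `` {p} \<subseteq> {a, q}"
      using card_mono[of "{a, q}" "A `` {p}"] ne by auto
    then obtain r where r: "(p, r) \<in> A" "r \<noteq> a" "r \<noteq> q" by auto
    then have r': "r \<in> V - {u, v}" "r \<noteq> p" "r \<noteq> b"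
      using adj_inV[OF r(1)] ne by (auto simp: adj)
    show False
    proof (rule switch[of u b p r])
      show "(u, b) \<in> (edit A [(u, b), (p, r)] [(u, p), (b, r)])\<^sup>*"
        by (rule edit_path[of _ _ _ "[v, b]"]) (use ne r' in \<open>auto simp: adj\<close>)
      show "(p, r) \<in> (edit A [(u, b), (p, r)] [(u, p), (b, r)])\<^sup>*"
        by (rule edit_path[of _ _ _ "[u, v, b, r]"]) (use ne r' in \<open>auto simp: adj\<close>)
      show "0 \<le> (x u - x r) * (x p - x b)"
        using above[OF r'(1)] x1 \<open>x p \<le> x b\<close> by (intro mult_nonpos_nonpos) auto
    qed (use r r' ne above[OF r'(1)] x1 in \<open>auto simp: adj\<close>)
  qed
  let ?S = "{u, v, a, b}"
  have pq: "(p, q) \<in> A"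
  proof (rule two_cut[of ?S a b])
    show "card (V - ?S) \<ge> 6" using ne by (intro card_Diff_ge_6) auto
    show "(a, r) \<in> (A \<inter> ?S \<times> ?S)\<^sup>*" if "r \<in> ?S" for r
    proof -
      have "r = a \<or> (a, r) \<in> A \<inter> ?S \<times> ?S" using that by (auto simp: adj)
      then show ?thesis by auto
    qed
    show "c = a \<and> d = p \<or> c = b \<and> d = q" if "c \<in> ?S" "d \<notin> ?S" "(c, d) \<in> A" for c d
      using that by (auto simp: adj)
  qed (use V ne deg4 xap xbp xpq in \<open>auto simp: adj\<close>)
  have s: "x p + x q = l\<^sup>2 - 2 * l - 3"
  proof -
    have "x p + x q = (l - 1) * (x a + x b) - 4" using e(3,4) xv by (simp add: algebra_simps)
    also have "x a + x b = l - 1" using e(1) xv by simp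
    finally show ?thesis by (simp add: algebra_simps power2_eq_square)
  qed
  \<comment> \<open>Round values suffice, since the bound obtained for the gain stays positive at
    \<open>l = 4\<close>.\<close>
  define z where "z r = (if r = v then 1 else if r = a then 1 / 3 else if r = b then 1 / 3 else 0 :: real)" for r
  show False
  proof (rule edit_contradiction[of "[(u, v), (p, q)]" "[(v, p), (v, q)]" "{v, a, b}" z])
    show "(c, d) \<in> (edit A [(u, v), (p, q)] [(v, p), (v, q)])\<^sup>*"
      if "(c, d) \<in> set [(u, v), (p, q)]" for c d
    proof -
      have "(u, v) \<in> (edit A [(u, v), (p, q)] [(v, p), (v, q)])\<^sup>*"
        by (rule edit_path[of _ _ _ "[a, v]"]) (use ne in \<open>auto simp: adj\<close>)
      moreover have "(p, q) \<in> (edit A [(u, v), (p, q)] [(v, p), (v, q)])\<^sup>*"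
        by (rule edit_path[of _ _ _ "[v, q]"]) (use ne in \<open>auto simp: adj\<close>)
      ultimately show ?thesis using that by auto
    qed
    show "deg A r + inc [(v, p), (v, q)] r \<le> 4 + inc [(u, v), (p, q)] r" if "r \<in> V" for r
      using deg4[of r] that degs ne by (cases "r \<in> {u, v}") auto
    show "\<exists>r\<in>V. deg A r + inc [(v, p), (v, q)] r = 4 + inc [(u, v), (p, q)] r"
      using degs ne V by (intro bexI[of _ v]) auto
    show "\<exists>r\<in>V. deg A r + inc [(v, p), (v, q)] r < 4 + inc [(u, v), (p, q)] r"
      using degs ne V by (intro bexI[of _ u]) auto
    define s where "s = x p + x q"
    have "(x p - x q)\<^sup>2 \<ge> 0" by simp
    then have a: "4 * (x p * x q) \<le> s\<^sup>2" by (simp add: s_def power2_eq_square algebra_simps)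
    \<comment> \<open>Tangent of \<open>s\<close> as a function of \<open>l\<close> at
      \<open>18 / 5\<close>, where \<open>s = 69 / 25\<close>. Below, \<open>s^2\<close> is bounded
      by its chord over \<open>69 / 25 \<le> s \<le> 5\<close>, and everything becomes
      linear.\<close>
    have "0 \<le> (l - 18 / 5)\<^sup>2" by simp
    then have s_ge: "26 / 5 * l - 399 / 25 \<le> s"
      unfolding s_def s by (simp add: power2_eq_square algebra_simps)
    have "s < 5" 
    proof -
      have "0 < (4 - l) * (l + 2)" using l_pos l_less_4 by simp
      then show ?thesis unfolding s_def s by (simp add: power2_eq_square algebra_simps)
    qed
    then have "0 \<le> (5 - s) * (s - 69 / 25)" using s_ge l by (intro mult_nonneg_nonneg) auto
    then have "s\<^sup>2 \<le> 194 / 25 * s - 69 / 5" by (simp add: power2_eq_square field_simps)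
    then have "22 / 9 + 11 / 9 * l < 4 * s - s\<^sup>2 / 2"
      using s_ge l l_less_4 by linarith
    then show "2 * quad_list [(u, v), (p, q)] (\<lambda>r. x r + z r) <
      (\<Sum>s\<in>{v, a, b}. \<Sum>t\<in>{v, a, b}. if (s, t) \<in> A then z s * z t else 0)
      - l * (\<Sum>s\<in>{v, a, b}. (z s)\<^sup>2) + 2 * quad_list [(v, p), (v, q)] (\<lambda>r. x r + z r)"
      using a unfolding s_def by (simp add: z_def adj xv x1 ne power2_eq_square field_simps)
  qed (use V ne pq in \<open>auto simp: adj z_def\<close>)
qed

end

section \<open>The deficient vertices\<close>

lemma card_extend_1:
  assumes "finite N" "S \<subseteq> N" "card N = card S + 1"
  obtains z where "z \<notin> S" "N = insert z S"
proof -
  have "card (N - S) = 1" using assms by (simp add: card_Diff_subset finite_subset)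
  then obtain z where "N - S = {z}" by (auto simp: card_1_singleton_iff)
  then show ?thesis using that[of z] assms(2) by auto
qed

lemma card_extend_2:
  assumes "finite N" "S \<subseteq> N" "card N = card S + 2"
  obtains p q where "p \<noteq> q" "p \<notin> S" "q \<notin> S" "N = insert p (insert q S)"
proof -
  have "card (N - S) = 2" using assms by (simp add: card_Diff_subset finite_subset)
  then obtain p q where "N - S = {p, q}" "p \<noteq> q" by (auto simp: card_2_iff)
  then show ?thesis using that[of p q] assms(2) by auto
qed

text \<open>After its last visit to \<open>u\<close> a walk avoids \<open>u\<close>. Hence one edge
  at \<open>u\<close> suffices to reach \<open>v\<close>, and any other edge at \<open>u\<close> may
  be moved.\<close>

lemma rtrancl_first_step:
  assumes "(u, v) \<in> A\<^sup>*"
  shows "v = u \<or> (\<exists>w. (u, w) \<in> A \<and> (w, v) \<in> (A \<inter> (- {u}) \<times> (- {u}))\<^sup>*)"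
  using assms
proof (induction rule: rtrancl_induct)
  case (step v v')
  show ?case
  proof (cases "v' = u \<or> v = u")
    case False
    then obtain w where "(u, w) \<in> A" "(w, v) \<in> (A \<inter> (- {u}) \<times> (- {u}))\<^sup>*"
      using step by auto
    moreover have "(v, v') \<in> A \<inter> (- {u}) \<times> (- {u})" using False step by auto
    ultimately show ?thesis by (meson rtrancl.rtrancl_into_rtrancl)
  qed (use step in auto)
qed auto

context extremal
begin

lemma ex_nb: "v \<in> V \<Longrightarrow> A `` {v} \<noteq> {}"
  using closed_all[of v "{v}"] card_mono[of "{v}" V] card10 by fastforce

lemma nb_extend_1:
  assumes "deg A v = card S + 1" "S \<subseteq> A `` {v}"
  obtains z where "z \<notin> S" "A `` {v} = insert z S"
  using card_extend_1[OF fin_nb, of S v] assms unfolding deg_def by metis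

lemma nb_extend_2:
  assumes "deg A v = card S + 2" "S \<subseteq> A `` {v}"
  obtains p q where "p \<noteq> q" "p \<notin> S" "q \<notin> S" "A `` {v} = insert p (insert q S)"
  using card_extend_2[OF fin_nb, of S v] assms unfolding deg_def by metis

lemma not_closed:
  assumes "U \<subseteq> V" "U \<noteq> {}" "card U < 10" "finite U"
  obtains a b where "a \<in> U" "b \<notin> U" "(a, b) \<in> A"
proof (rule ccontr)
  assume "\<not> thesis"
  then have "\<And>a b. a \<in> U \<Longrightarrow> (a, b) \<in> A \<Longrightarrow> b \<in> U" using that by blast
  then have "V \<subseteq> U" using closed_all[of _ U] assms(1,2) by blast
  then show False using card_mono[of U V] assms(3,4) card10 by simp
qed

section \<open>Removing the normalisation and naming the outer neighbours\<close>

lemma triangle_22: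
  assumes "A `` {u} = {v, w}" "A `` {v} = {u, w}" "A `` {w} = {u, v, p, q}"
    and "distinct [u, v, w, p, q]" "\<And>r. r \<in> V - {u, v} \<Longrightarrow> deg A r = 4"
  shows False
proof -
  have "x u > 0" using assms(1) adj_inV xpos by blast
  then show False
    using extremal.triangle_22_normalised[OF scale[of "1 / x u"] assms] by simp
qed

lemma triangle_233:
  assumes "A `` {u} = {v, w}" "A `` {v} = {u, w, z}" "A `` {w} = {u, v, z}"
      "A `` {z} = {v, w, p, q}"
    and "distinct [u, v, w, z, p, q]" "\<And>r. r \<in> V - {u, v, w} \<Longrightarrow> deg A r = 4"
  shows False
proof -
  have "x u > 0" using assms(1) adj_inV xpos by blast
  then show False
    using extremal.triangle_233_normalised[OF scale[of "1 / x u"] assms] by simp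
qed

lemma pendant_aux:
  assumes nb: "A `` {u} = {v}" "A `` {v} = {u, p, q}" and dist: "distinct [u, v, p, q]"
    and pq: "(p, q) \<in> A" and deg4: "\<And>r. r \<in> V - {u, v} \<Longrightarrow> deg A r = 4" and le: "x p \<le> x q"
  shows False
proof -
  have "u \<in> V" "p \<in> V" using nb adj_inV[of u v] adj_inV[of v p] by auto
  have "{v, q} \<subseteq> A `` {p}" using nb pq adjD[of v p] by auto
  moreover have "deg A p = card {v, q} + 2" using deg4[of p] \<open>p \<in> V\<close> dist by auto
  ultimately obtain p1 p2 where p12: "p1 \<noteq> p2" "p1 \<notin> {v, q}" "p2 \<notin> {v, q}"
      "A `` {p} = {p1, p2, v, q}"
    by (meson nb_extend_2)
  have "(p, u) \<notin> A" using nb_iff(2)[OF nb(1)] dist by auto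
  then have "p1 \<noteq> u" "p2 \<noteq> u" using p12 by auto
  moreover have "p1 \<noteq> p" "p2 \<noteq> p" using p12 adj_irrefl by auto
  ultimately have dist': "distinct [u, v, p, q, p1, p2]" using dist p12 by auto
  have nbp: "A `` {p} = {v, q, p1, p2}" using p12(4) by auto
  have "x u > 0" using \<open>u \<in> V\<close> xpos by simp
  then show False
    using extremal.pendant_normalised[OF scale[of "1 / x u"] nb nbp dist' deg4] le
    by (simp add: divide_right_mono)
qed

lemma pendant:
  assumes nb: "A `` {u} = {v}" "A `` {v} = {u, p, q}" and dist: "distinct [u, v, p, q]"
    and deg4: "\<And>r. r \<in> V - {u, v} \<Longrightarrow> deg A r = 4"
  shows False
proof -
  note adj = nb[THEN nb_iff(1)] nb[THEN nb_iff(2)]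
  have V: "u \<in> V" "v \<in> V" using adj_inV[of u v] by (auto simp: adj)
  have pq: "(p, q) \<in> A"
  proof (rule two_cut_vertex[of "{u, v}" v])
    show "card (V - {u, v}) \<ge> 6" using dist by (intro card_Diff_ge_6) auto
    show "(v, r) \<in> (A \<inter> {u, v} \<times> {u, v})\<^sup>*" if "r \<in> {u, v}" for r
    proof -
      have "r = v \<or> (v, r) \<in> A \<inter> {u, v} \<times> {u, v}" using that by (auto simp: adj)
      then show ?thesis by auto
    qed
  qed (use V dist deg4 in \<open>auto simp: adj\<close>)
  have nb2: "A `` {v} = {u, q, p}" using nb(2) by auto
  show False
  proof (cases "x p \<le> x q")
    case True
    then show False using pendant_aux[OF nb dist pq deg4] by simp
  next
    case False
    then show False using pendant_aux[OF nb(1) nb2 _ adjD[OF pq] deg4] dist by auto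
  qed
qed

text \<open>Three cases: \<open>a\<close> and \<open>b\<close> are not adjacent, or each has one
  more neighbour, and these two differ or coincide.\<close>

lemma adjacent_twins_aux:
  assumes nb: "A `` {u} = {v, a, b}" "A `` {v} = {u, a, b}" and dist: "distinct [u, v, a, b]"
    and deg4: "\<And>r. r \<in> V - {u, v} \<Longrightarrow> deg A r = 4" and le: "x a \<le> x b"
  shows False
proof -
  note adj = nb[THEN nb_iff(1)] nb[THEN nb_iff(2)]
  have V: "u \<in> V" "v \<in> V" "a \<in> V" "b \<in> V"
    using adj_inV[of u a] adj_inV[of v b] by (auto simp: adj)
  have xu: "x u > 0" using V xpos by simp
  have degab: "deg A a = 4" "deg A b = 4" using V dist deg4 by auto
  show False
  proof (cases "(a, b) \<in> A")
    case False
    have "deg A a = card {u, v} + 2" using degab dist by simp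
    moreover have "{u, v} \<subseteq> A `` {a}" by (auto simp: adj)
    ultimately obtain a1 a2 where a12: "a1 \<notin> {u, v}" "A `` {a} = insert a1 (insert a2 {u, v})"
      by (meson nb_extend_2)
    then have a1: "(a, a1) \<in> A" by auto
    have "distinct [u, v, a, b, a1]"
      using dist a12(1) a1 False adj_irrefl by auto
    then show False
      using extremal.adjacent_twins_nonadjacent_nbs_normalised[OF scale[of "1 / x u"] nb a1 False _ deg4]
        xu le by (simp add: divide_right_mono)
  next
    case True
    have "deg A a = card {u, v, b} + 1" "deg A b = card {u, v, a} + 1" using degab dist by auto
    moreover have "{u, v, b} \<subseteq> A `` {a}" "{u, v, a} \<subseteq> A `` {b}"
      using True adjD[OF True] by (auto simp: adj)
    ultimately obtain p q where p: "p \<notin> {u, v, b}" "A `` {a} = insert p {u, v, b}"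
      and q: "q \<notin> {u, v, a}" "A `` {b} = insert q {u, v, a}"
      by (meson nb_extend_1)
    have pq: "(a, p) \<in> A" "(b, q) \<in> A" using p q by auto
    then have ne: "p \<noteq> a" "q \<noteq> b" using adj_irrefl by auto
    have nb': "A `` {a} = {u, v, b, p}" "A `` {b} = {u, v, a, q}" using p q by auto
    show False
    proof (cases "p = q")
      case False
      then have "distinct [u, v, a, b, p, q]" using dist p(1) q(1) ne by auto
      then show False
        using extremal.adjacent_twins_two_cut_normalised[OF scale[of "1 / x u"] nb nb' _ deg4]
          xu le by (simp add: divide_right_mono)
    next
      case True
      have "p \<in> V" using adj_inV[OF pq(1)] by simp
      then have "deg A p = card {a, b} + 2" using deg4[of p] p(1) dist by simp
      moreover have "{a, b} \<subseteq> A `` {p}" using adjD[OF pq(1)] adjD[OF pq(2)] True by auto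
      ultimately obtain p' q' where pq': "p' \<noteq> q'" "p' \<notin> {a, b}" "q' \<notin> {a, b}"
          "A `` {p} = insert p' (insert q' {a, b})"
        by (meson nb_extend_2)
      then have "(p, p') \<in> A" "(p, q') \<in> A" by auto
      then have "p' \<noteq> p" "q' \<noteq> p" "p' \<notin> {u, v}" "q' \<notin> {u, v}"
        using adj_irrefl p(1) ne by (auto simp: adj)
      then have dist': "distinct [u, v, a, b, p, p', q']" using dist p(1) ne pq' by auto
      have nbp: "A `` {p} = {a, b, p', q'}" using pq' by auto
      have nbb: "A `` {b} = {u, v, a, p}" using nb'(2) True by simp
      show False
        using extremal.adjacent_twins_common_nb_normalised[OF scale[of "1 / x u"] nb nb'(1) nbb nbp dist' deg4]
          xu by simp
    qed
  qed
qed

lemma adjacent_twins: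
  assumes nb: "A `` {u} = {v, a, b}" "A `` {v} = {u, a, b}" and dist: "distinct [u, v, a, b]"
    and deg4: "\<And>r. r \<in> V - {u, v} \<Longrightarrow> deg A r = 4"
  shows False
proof (cases "x a \<le> x b")
  case True
  then show False using adjacent_twins_aux[OF nb dist deg4] by simp
next
  case False
  have "A `` {u} = {v, b, a}" "A `` {v} = {u, b, a}" using nb by auto
  then show False using adjacent_twins_aux[of u v b a] dist deg4 False by auto
qed

section \<open>Moving and adding edges at deficient vertices\<close>

text \<open>The form grows by twice \<open>x w * (x v - x u) \<ge> 0\<close>, so
  \<open>edit_eigen\<close> at \<open>v\<close> would give \<open>x w = 0\<close>.\<close>

lemma move_edge:
  assumes uv: "u \<in> V" "v \<in> V" "u \<noteq> v" "deg A u < 4" "deg A v < 4" "x u \<le> x v"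
    and w: "(u, w) \<in> A" "w \<noteq> v" "(v, w) \<notin> A"
    and conn: "(u, v) \<in> (edit A [(u, w)] [(v, w)])\<^sup>*"
  shows False
proof -
  let ?rs = "[(u, w)]" and ?ns = "[(v, w)]"
  have ne: "u \<noteq> w" using w(1) by auto
  have V: "w \<in> V" using adj_inV[OF w(1)] by simp
  have rs: "distinct (arcs_of ?rs)" "set ?rs \<subseteq> A" using ne w by auto
  have ns: "distinct (arcs_of ?ns)" "set ?ns \<inter> A = {}" "set ?ns \<subseteq> V \<times> V"
    using w V uv by auto
  have adm': "admissible V (edit A ?rs ?ns)"
  proof (rule admissible_edit[OF rs ns])
    have "(v, w) \<in> edit A ?rs ?ns" by simp
    then show "(a, b) \<in> (edit A ?rs ?ns)\<^sup>*" if "(a, b) \<in> set ?rs" for a b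
      using that conn by (auto intro: rtrancl_into_rtrancl)
    show "deg A r + inc ?ns r \<le> 4 + inc ?rs r" if "r \<in> V" for r
      using deg_le[OF that] uv w by auto
    obtain r where "r \<in> V" "deg A r = 4" using ex_deg4 by auto
    then show "\<exists>r\<in>V. deg A r + inc ?ns r = 4 + inc ?rs r"
      using uv by (intro bexI[of _ r]) auto
    show "\<exists>r\<in>V. deg A r + inc ?ns r < 4 + inc ?rs r"
      using uv w by (intro bexI[of _ u]) auto
  qed
  have "quad_list ?rs x \<le> quad_list ?ns x"
    using uv(6) xpos[OF V] by (simp add: mult_right_mono)
  then have "load ?ns x v = load ?rs x v"
    using edit_eigen[OF rs ns(1,2) adm'] uv(2) by blast
  then show False using uv(3) w(2) xpos[OF V] by simp
qed

text \<open>A new edge strictly increases the form at the positive vector \<open>x\<close>, so the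
  result cannot be admissible. The only clause that can fail is nonregularity.\<close>

lemma add_edge:
  assumes uv: "u \<in> V" "v \<in> V" "u \<noteq> v" "deg A u < 4" "deg A v < 4" "(u, v) \<notin> A"
  shows "deg A u = 3" "deg A v = 3" "\<And>r. r \<in> V - {u, v} \<Longrightarrow> deg A r = 4"
proof -
  let ?ns = "[(u, v)]"
  have rs: "distinct (arcs_of [])" "set [] \<subseteq> A" by auto
  have ns: "distinct (arcs_of ?ns)" "set ?ns \<inter> A = {}" "set ?ns \<subseteq> V \<times> V"
    using uv by auto
  have reg: "deg A r + inc ?ns r = 4" if r: "r \<in> V" for r
  proof (rule ccontr)
    assume *: "deg A r + inc ?ns r \<noteq> 4"
    have le: "deg A r + inc ?ns r \<le> 4" if "r \<in> V" for r
      using deg_le[OF that] uv by auto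
    have adm': "admissible V (edit A [] ?ns)"
    proof (rule admissible_edit[OF rs ns])
      show "deg A r + inc ?ns r \<le> 4 + inc [] r" if "r \<in> V" for r
        using le[OF that] by simp
      obtain d where "d \<in> V" "deg A d = 4" using ex_deg4 by auto
      then show "\<exists>r\<in>V. deg A r + inc ?ns r = 4 + inc [] r"
        using uv by (intro bexI[of _ d]) auto
      have "deg A r + inc ?ns r < 4" using * le[OF r] by linarith
      then show "\<exists>r\<in>V. deg A r + inc ?ns r < 4 + inc [] r"
        using r by (intro bexI[of _ r]) auto
    qed auto
    have "quad_list [] x \<le> quad_list ?ns x"
      using xpos uv by (simp add: less_imp_le)
    then have "load ?ns x u = load [] x u"
      using edit_eigen[OF rs ns(1,2) adm'] uv(1) by blast
    then show False using uv(3) xpos[OF uv(2)] by simp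
  qed
  show "deg A u = 3" "deg A v = 3" using reg[of u] reg[of v] uv by auto
  show "deg A r = 4" if "r \<in> V - {u, v}" for r using reg[of r] that by auto
qed

lemma deg_pos: "v \<in> V \<Longrightarrow> deg A v > 0"
  using ex_nb[of v] fin_nb by (simp add: deg_def card_gt_0_iff)

lemma nb_singleton:
  assumes "deg A u = 1" "(u, v) \<in> A"
  shows "A `` {u} = {v}"
proof -
  obtain w where w: "A `` {u} = {w}"
    using assms(1) unfolding deg_def by (rule card_1_singletonE)
  have "v \<in> A `` {u}" using assms(2) by simp
  then show ?thesis unfolding w by simp
qed

lemma move_edge_adjacent:
  assumes uv: "(u, v) \<in> A" "deg A u < 4" "deg A v < 4" "x u \<le> x v"
    and w: "(u, w) \<in> A" "w \<noteq> v" "(v, w) \<notin> A"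
  shows False
proof (rule move_edge[of u v w])
  have "u \<noteq> v" using uv(1) by auto
  then show "(u, v) \<in> (edit A [(u, w)] [(v, w)])\<^sup>*"
    using uv(1) w by (auto intro!: r_into_rtrancl)
qed (use assms adj_inV[OF uv(1)] in auto)

text \<open>With equal neighbourhoods, \<open>nonadjacent_twins\<close> makes the three neighbours
  pairwise adjacent, which closes off five vertices. Otherwise an edge moves from \<open>u\<close>
  to \<open>v\<close>; a common neighbour, or the first edge of a walk to \<open>v\<close>, keeps
  the graph connected.\<close>

lemma nonadjacent_deficient_aux:
  assumes V: "u \<in> V" "v \<in> V" "u \<noteq> v" and nuv: "(u, v) \<notin> A"
    and degs: "deg A u = 3" "deg A v = 3"
    and deg4: "\<And>r. r \<in> V - {u, v} \<Longrightarrow> deg A r = 4" and le: "x u \<le> x v"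
  shows False
proof (cases "A `` {u} \<subseteq> A `` {v}")
  case True
  then have nbuv: "A `` {v} = A `` {u}"
    using card_seteq[OF fin_nb True] degs by (simp add: deg_def)
  obtain a b c where "A `` {u} = {a, b, c}" and abc: "a \<noteq> b" "b \<noteq> c" "a \<noteq> c"
    using degs(1) unfolding deg_def by (auto simp: card_3_iff)
  then have nb: "A `` {u} = {a, b, c}" "A `` {v} = {a, b, c}" using nbuv by auto
  note adj = nb[THEN nb_iff(1)] nb[THEN nb_iff(2)]
  have ne: "a \<noteq> u" "b \<noteq> u" "c \<noteq> u" "a \<noteq> v" "b \<noteq> v" "c \<noteq> v"
  proof -
    have "(u, a) \<in> A" "(u, b) \<in> A" "(u, c) \<in> A" "(v, a) \<in> A" "(v, b) \<in> A" "(v, c) \<in> A"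
      by (auto simp: adj)
    then show "a \<noteq> u" "b \<noteq> u" "c \<noteq> u" "a \<noteq> v" "b \<noteq> v" "c \<noteq> v" by auto
  qed
  have nb': "A `` {u} = {a, c, b}" "A `` {v} = {a, c, b}" "A `` {u} = {b, c, a}" "A `` {v} = {b, c, a}"
    using nb by auto
  have "(a, b) \<in> A"
    using nonadjacent_twins[OF nb _ _ deg4] V abc ne by auto
  moreover have "(a, c) \<in> A"
    using nonadjacent_twins[OF nb'(1,2) _ _ deg4] V abc ne by auto
  moreover have "(b, c) \<in> A"
    using nonadjacent_twins[OF nb'(3,4) _ _ deg4] V abc ne by auto
  ultimately have sub: "{u, v, b, c} \<subseteq> A `` {a}" "{u, v, a, c} \<subseteq> A `` {b}" "{u, v, a, b} \<subseteq> A `` {c}"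
    using adjD by (auto simp: adj)
  have "a \<in> V" "b \<in> V" "c \<in> V" using adj_inV[of u a] adj_inV[of u b] adj_inV[of u c] by (auto simp: adj)
  then have four: "card (A `` {r}) = 4" if "r \<in> {a, b, c}" for r
    using deg4[of r] that ne by (auto simp: deg_def)
  have "{u, v, b, c} = A `` {a}" "{u, v, a, c} = A `` {b}" "{u, v, a, b} = A `` {c}"
  proof -
    have "card {u, v, b, c} = 4" "card {u, v, a, c} = 4" "card {u, v, a, b} = 4"
      using V abc ne by auto
    then show "{u, v, b, c} = A `` {a}" "{u, v, a, c} = A `` {b}" "{u, v, a, b} = A `` {c}"
      using card_seteq[OF fin_nb sub(1)] card_seteq[OF fin_nb sub(2)] card_seteq[OF fin_nb sub(3)]
        four by simp_all
  qed
  then have cl: "A `` {r} \<subseteq> {u, v, a, b, c}" if "r \<in> {u, v, a, b, c}" for r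
    using nb that by blast
  obtain r s where "r \<in> {u, v, a, b, c}" "s \<notin> {u, v, a, b, c}" "(r, s) \<in> A"
    by (rule not_closed[of "{u, v, a, b, c}"])
      (use V \<open>a \<in> V\<close> \<open>b \<in> V\<close> \<open>c \<in> V\<close> abc ne in auto)
  then show False using cl[of r] by auto
next
  case False
  show False
  proof (cases "A `` {u} \<inter> A `` {v} = {}")
    case True
    have "(u, v) \<in> A\<^sup>*" using connA V by auto
    then obtain w1 where w1: "(u, w1) \<in> A" "(w1, v) \<in> (A \<inter> (- {u}) \<times> (- {u}))\<^sup>*"
      using rtrancl_first_step[of u v A] V(3) by auto
    have "\<not> A `` {u} \<subseteq> {w1}"
    proof
      assume "A `` {u} \<subseteq> {w1}"
      then have "card (A `` {u}) \<le> card {w1}" by (intro card_mono) auto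
      then show False using degs(1) by (simp add: deg_def)
    qed
    then obtain w where w: "(u, w) \<in> A" "w \<noteq> w1" by auto
    show False
    proof (rule move_edge[of u v w])
      have "(A \<inter> (- {u}) \<times> (- {u}))\<^sup>* \<subseteq> (edit A [(u, w)] [(v, w)])\<^sup>*"
        by (intro rtrancl_mono) auto
      moreover have "(u, w1) \<in> edit A [(u, w)] [(v, w)]" using w1 w by auto
      ultimately show "(u, v) \<in> (edit A [(u, w)] [(v, w)])\<^sup>*"
        using w1(2) by (meson converse_rtrancl_into_rtrancl subsetD)
    qed (use V degs le w nuv True in auto)
  next
    case c: False
    then obtain c where c: "(u, c) \<in> A" "(v, c) \<in> A" by auto
    obtain w where w: "(u, w) \<in> A" "(v, w) \<notin> A" using False by auto
    show False
    proof (rule move_edge[of u v w])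
      show "(u, v) \<in> (edit A [(u, w)] [(v, w)])\<^sup>*"
        by (rule edit_path[of _ _ _ "[c, v]"]) (use c w V adjD[OF c(2)] in auto)
    qed (use V degs le w nuv in auto)
  qed
qed

lemma deficient_clique:
  assumes "u \<in> V" "v \<in> V" "u \<noteq> v" "deg A u < 4" "deg A v < 4"
  shows "(u, v) \<in> A"
proof (rule ccontr)
  assume n: "(u, v) \<notin> A"
  note d = add_edge[OF assms n]
  show False
  proof (cases "x u \<le> x v")
    case True
    then show False using nonadjacent_deficient_aux[OF assms(1-3) n d] by simp
  next
    case False
    have "(v, u) \<notin> A" using n adjD by blast
    then show False
      using nonadjacent_deficient_aux[of v u] assms d False by auto
  qed
qed

section \<open>Case analysis on the number of deficient vertices\<close>

text \<open>Parity leaves the degree pairs 1,1 (a closed component), 1,3 (the pendant), 2,2 and 3,3.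
  In the last two, differing outer neighbourhoods are excluded by moving an edge to the end with the
  larger entry.\<close>

lemma two_deficient_aux:
  assumes uv: "(u, v) \<in> A" and degs: "deg A u < 4" "deg A v < 4" "deg A u \<le> deg A v"
      "even (deg A u + deg A v)"
    and deg4: "\<And>r. r \<in> V - {u, v} \<Longrightarrow> deg A r = 4"
  shows False
proof -
  have vu: "(v, u) \<in> A" using adjD[OF uv] .
  have V: "u \<in> V" "v \<in> V" using adj_inV[OF uv] by auto
  have ne: "u \<noteq> v" using uv by auto
  have "deg A u = 1 \<or> deg A u = 2 \<or> deg A u = 3" "deg A v = 1 \<or> deg A v = 2 \<or> deg A v = 3"
    using degs(1,2) deg_pos[OF V(1)] deg_pos[OF V(2)] by linarith+
  then consider "deg A u = 1" "deg A v = 1" | "deg A u = 1" "deg A v = 3" | "deg A u = 2" "deg A v = 2"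
    | "deg A u = 3" "deg A v = 3"
    using degs(3,4) by auto
  then show False
  proof cases
    case 1
    then have "A `` {u} = {v}" "A `` {v} = {u}"
      using uv vu nb_singleton by auto
    note nb = this
    obtain a b where "a \<in> {u, v}" "b \<notin> {u, v}" "(a, b) \<in> A"
      by (rule not_closed[of "{u, v}"]) (use V ne in auto)
    then show False using nb[THEN nb_iff(1)] by auto
  next
    case 2
    then have nbu: "A `` {u} = {v}" using uv by (intro nb_singleton)
    have "deg A v = card {u} + 2" "{u} \<subseteq> A `` {v}" using 2 vu by auto
    then obtain p q where pq: "p \<noteq> q" "p \<notin> {u}" "q \<notin> {u}" "A `` {v} = insert p (insert q {u})"
      by (rule nb_extend_2)
    then have "p \<noteq> v" "q \<noteq> v" using adj_irrefl[of v] by auto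
    then show False using pendant[of u v p q] nbu pq deg4 ne by auto
  next
    case 3
    have "deg A u = card {v} + 1" "{v} \<subseteq> A `` {u}" using 3 uv by auto
    then obtain w where w: "w \<notin> {v}" "A `` {u} = insert w {v}" by (rule nb_extend_1)
    have "deg A v = card {u} + 1" "{u} \<subseteq> A `` {v}" using 3 vu by auto
    then obtain w' where w': "w' \<notin> {u}" "A `` {v} = insert w' {u}" by (rule nb_extend_1)
    have uw: "(u, w) \<in> A" "(v, w') \<in> A" using w w' by auto
    then have ne': "w \<noteq> u" "w' \<noteq> v" by auto
    have nb: "A `` {u} = {v, w}" "A `` {v} = {u, w'}" using w w' by auto
    note adj = nb[THEN nb_iff(1)]
    show False
    proof (cases "w = w'")
      case False
      then show False
        using move_edge_adjacent[of u v w] move_edge_adjacent[of v u w'] uv vu degs w w' ne'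
        by (cases "x u \<le> x v") (auto simp: adj)
    next
      case True
      have "w \<in> V" using adj_inV[OF uw(1)] by simp
      then have "deg A w = card {u, v} + 2" using deg4[of w] w(1) ne ne' by auto
      moreover have "{u, v} \<subseteq> A `` {w}" using adjD[OF uw(1)] adjD[OF uw(2)] True by auto
      ultimately obtain p q where pq: "p \<noteq> q" "p \<notin> {u, v}" "q \<notin> {u, v}"
          "A `` {w} = insert p (insert q {u, v})"
        by (rule nb_extend_2)
      then have "p \<noteq> w" "q \<noteq> w" using adj_irrefl[of w] by auto
      moreover have "A `` {w} = {u, v, p, q}" using pq by auto
      ultimately show False
        using triangle_22[of u v w p q] nb True pq w ne ne' deg4 by auto
    qed
  next
    case 4
    have c: "card (A `` {u} - {v}) = 2" "card (A `` {v} - {u}) = 2"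
      using 4 uv vu fin_nb by (auto simp: deg_def)
    show False
    proof (cases "A `` {u} - {v} = A `` {v} - {u}")
      case True
      obtain a b where ab: "A `` {u} - {v} = {a, b}" "a \<noteq> b"
        using c by (auto simp: card_2_iff)
      then have nb: "A `` {u} = {v, a, b}" "A `` {v} = {u, a, b}" using True uv vu by auto
      moreover have "distinct [u, v, a, b]"
        using ab True ne adj_irrefl[of u] adj_irrefl[of v] by auto
      ultimately show False using adjacent_twins deg4 by blast
    next
      case False
      have "\<not> A `` {u} - {v} \<subseteq> A `` {v} - {u}" "\<not> A `` {v} - {u} \<subseteq> A `` {u} - {v}"
        using False c card_seteq[of "A `` {v} - {u}" "A `` {u} - {v}"]
          card_seteq[of "A `` {u} - {v}" "A `` {v} - {u}"] fin_nb by auto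
      then obtain w w' where "(u, w) \<in> A" "w \<noteq> v" "(v, w) \<notin> A" "(v, w') \<in> A" "w' \<noteq> u" "(u, w') \<notin> A"
        using adj_irrefl by blast
      then show False
        using move_edge_adjacent[of u v w] move_edge_adjacent[of v u w'] uv vu degs
        by (cases "x u \<le> x v") auto
    qed
  qed
qed

lemma two_deficient:
  assumes "(u, v) \<in> A" "deg A u < 4" "deg A v < 4" "even (deg A u + deg A v)"
    and "\<And>r. r \<in> V - {u, v} \<Longrightarrow> deg A r = 4"
  shows False
proof (cases "deg A u \<le> deg A v")
  case True
  then show False using two_deficient_aux assms by blast
next
  case False
  have "deg A r = 4" if "r \<in> V - {v, u}" for r using assms(5)[of r] that by auto
  moreover have "even (deg A v + deg A u)" using assms(4) by (simp add: add.commute)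
  ultimately show False using two_deficient_aux[OF adjD[OF assms(1)] assms(3,2)] False by auto
qed

lemma three_deficient_aux:
  assumes uvw: "(u, v) \<in> A" "(u, w) \<in> A" "(v, w) \<in> A"
    and degs: "deg A u = 2" "deg A v = 3" "deg A w = 3"
    and deg4: "\<And>r. r \<in> V - {u, v, w} \<Longrightarrow> deg A r = 4"
  shows False
proof -
  have ne: "u \<noteq> v" "u \<noteq> w" "v \<noteq> w" using uvw by auto
  have wvu: "(v, u) \<in> A" "(w, u) \<in> A" "(w, v) \<in> A" using uvw adjD by auto
  have nbu: "A `` {u} = {v, w}"
    using card_seteq[OF fin_nb, of "{v, w}" u] degs(1) ne uvw by (auto simp: deg_def)
  have "deg A v = card {u, w} + 1" "{u, w} \<subseteq> A `` {v}" using degs ne uvw wvu by auto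
  then obtain z where z: "z \<notin> {u, w}" "A `` {v} = insert z {u, w}" by (rule nb_extend_1)
  have "deg A w = card {u, v} + 1" "{u, v} \<subseteq> A `` {w}" using degs ne uvw wvu by auto
  then obtain z' where z': "z' \<notin> {u, v}" "A `` {w} = insert z' {u, v}" by (rule nb_extend_1)
  have zadj: "(v, z) \<in> A" "(w, z') \<in> A" using z z' by auto
  then have ne': "z \<noteq> v" "z' \<noteq> w" by auto
  show False
  proof (cases "z = z'")
    case False
    have nb: "A `` {v} = insert z {u, w}" "A `` {w} = insert z' {u, v}" using z z' by auto
    show False
      using move_edge_adjacent[of v w z] move_edge_adjacent[of w v z'] uvw wvu degs z z' ne' False
      by (cases "x v \<le> x w") (auto simp: nb[THEN nb_iff(1)])
  next
    case True
    have "z \<in> V" using adj_inV[OF zadj(1)] by simp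
    then have "deg A z = card {v, w} + 2" using deg4[of z] z(1) ne ne' by auto
    moreover have "{v, w} \<subseteq> A `` {z}" using adjD[OF zadj(1)] adjD[OF zadj(2)] True by auto
    ultimately obtain p q where pq: "p \<noteq> q" "p \<notin> {v, w}" "q \<notin> {v, w}"
        "A `` {z} = insert p (insert q {v, w})"
      by (rule nb_extend_2)
    have zpq: "(z, p) \<in> A" "(z, q) \<in> A" using pq by auto
    then have "p \<noteq> z" "q \<noteq> z" by auto
    moreover have "(z, u) \<notin> A" using nb_iff(2)[OF nbu] z ne' by auto
    then have "p \<noteq> u" "q \<noteq> u" using zpq by auto
    ultimately have dist: "distinct [u, v, w, z, p, q]" using pq z ne ne' by auto
    have "A `` {v} = {u, w, z}" "A `` {w} = {u, v, z}" "A `` {z} = {v, w, p, q}"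
      using pq z z' True by auto
    then show False using triangle_233[OF nbu _ _ _ dist deg4] by blast
  qed
qed

text \<open>Adjacency gives degrees at least 2 and parity an even number of 3s: all degrees 2 is a
  triangle component, so one 2 and two 3s remain.\<close>

lemma three_deficient:
  assumes uvw: "(u, v) \<in> A" "(u, w) \<in> A" "(v, w) \<in> A"
    and degs: "deg A u < 4" "deg A v < 4" "deg A w < 4" "even (deg A u + deg A v + deg A w)"
    and deg4: "\<And>r. r \<in> V - {u, v, w} \<Longrightarrow> deg A r = 4"
  shows False
proof -
  have ne: "u \<noteq> v" "u \<noteq> w" "v \<noteq> w" using uvw by auto
  have wvu: "(v, u) \<in> A" "(w, u) \<in> A" "(w, v) \<in> A" using uvw adjD by auto
  have V: "u \<in> V" "v \<in> V" "w \<in> V" using uvw adj_inV by auto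
  have sub: "{v, w} \<subseteq> A `` {u}" "{u, w} \<subseteq> A `` {v}" "{u, v} \<subseteq> A `` {w}" using uvw wvu by auto
  then have ge: "2 \<le> deg A u" "2 \<le> deg A v" "2 \<le> deg A w"
    using card_mono[OF fin_nb sub(1)] card_mono[OF fin_nb sub(2)] card_mono[OF fin_nb sub(3)] ne
    by (auto simp: deg_def)
  then have d: "deg A u = 2 \<or> deg A u = 3" "deg A v = 2 \<or> deg A v = 3" "deg A w = 2 \<or> deg A w = 3"
    using degs by auto
  then consider "deg A u = 2" "deg A v = 2" "deg A w = 2" | "deg A u = 2" "deg A v = 3" "deg A w = 3"
    | "deg A u = 3" "deg A v = 2" "deg A w = 3" | "deg A u = 3" "deg A v = 3" "deg A w = 2"
    using degs(4) by auto
  then show False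
  proof cases
    case 1
    then have "{v, w} = A `` {u}" "{u, w} = A `` {v}" "{u, v} = A `` {w}"
      using sub ne by (auto intro!: card_seteq[OF fin_nb] simp: deg_def)
    then have cl: "A `` {r} \<subseteq> {u, v, w}" if "r \<in> {u, v, w}" for r using that by blast
    obtain r s where "r \<in> {u, v, w}" "s \<notin> {u, v, w}" "(r, s) \<in> A"
      by (rule not_closed[of "{u, v, w}"]) (use V ne in auto)
    then show False using cl[of r] by auto
  next
    case 2
    then show False using three_deficient_aux[OF uvw _ _ _ deg4] by simp
  next
    case 3
    then show False using three_deficient_aux[of v u w] uvw wvu deg4 by auto
  next
    case 4
    then show False using three_deficient_aux[of w u v] uvw wvu deg4 by auto
  qed
qed

lemma degree_sequence: "\<exists>v\<in>V. deg A v = 2 \<and> (\<forall>u\<in>V - {v}. deg A u = 4)"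
proof -
  define W where "W = {v \<in> V. deg A v < 4}"
  have WV: "W \<subseteq> V" by (auto simp: W_def)
  have finW: "finite W" using WV finV finite_subset by blast
  have clique: "(u, v) \<in> A" if "u \<in> W" "v \<in> W" "u \<noteq> v" for u v
    using deficient_clique that by (auto simp: W_def)
  have deg4: "deg A r = 4" if "r \<in> V - W" for r
    using that deg_le[of r] by (auto simp: W_def)
  have "A \<inter> V \<times> V = A" using subV by auto
  then have "even (\<Sum>v\<in>V. deg A v)"
    using even_card_sym[OF finV symA irreflA] sum_deg[OF finA subV finV] by simp
  moreover have "(\<Sum>v\<in>V. deg A v) = (\<Sum>v\<in>V - W. deg A v) + (\<Sum>v\<in>W. deg A v)"
    by (rule sum.subset_diff[OF WV finV])
  moreover have "(\<Sum>v\<in>V - W. deg A v) = 4 * card (V - W)" using deg4 by simp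
  ultimately have ev: "even (\<Sum>v\<in>W. deg A v)" by simp
  have sub: "W - {v} \<subseteq> A `` {v}" if "v \<in> W" for v using clique that by auto
  have "W \<noteq> {}" using ex_deg_less by (auto simp: W_def)
  \<comment> \<open>Four or more pairwise adjacent vertices of degree at most 3 would form a
    complete component on four vertices.\<close>
  have "card W \<le> 3"
  proof (rule ccontr)
    assume *: "\<not> card W \<le> 3"
    have nb: "A `` {v} = W - {v}" if "v \<in> W" for v
    proof -
      have "card (A `` {v}) \<le> 3" using that by (auto simp: W_def deg_def)
      moreover have "card (W - {v}) = card W - 1" using that finW by simp
      ultimately show ?thesis using card_seteq[OF fin_nb sub[OF that]] * by simp
    qed
    obtain v where "v \<in> W" using \<open>W \<noteq> {}\<close> by auto
    have "card (W - {v}) = deg A v" unfolding deg_def nb[OF \<open>v \<in> W\<close>] ..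
    moreover have "deg A v < 4" using \<open>v \<in> W\<close> by (simp add: W_def)
    ultimately have "card (W - {v}) \<le> 3" by simp
    then have "card W < 10" using \<open>v \<in> W\<close> finW by simp
    obtain a b where "a \<in> W" "b \<notin> W" "(a, b) \<in> A"
      by (rule not_closed[OF WV \<open>W \<noteq> {}\<close> \<open>card W < 10\<close> finW])
    then have "b \<in> A `` {a}" by simp
    then show False using nb[OF \<open>a \<in> W\<close>] \<open>b \<notin> W\<close> by simp
  qed
  moreover have "card W > 0" using \<open>W \<noteq> {}\<close> finW by (simp add: card_gt_0_iff)
  ultimately consider "card W = 1" | "card W = 2" | "card W = 3" by linarith
  then show ?thesis
  proof cases
    case 1
    then obtain v where v: "W = {v}" by (auto simp: card_1_singleton_iff)
    then have "v \<in> V" "deg A v < 4" by (auto simp: W_def)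
    moreover have "even (deg A v)" using ev v by simp
    ultimately have "deg A v = 2"
    proof -
      have "deg A v = 1 \<or> deg A v = 2 \<or> deg A v = 3"
        using \<open>deg A v < 4\<close> deg_pos[OF \<open>v \<in> V\<close>] by linarith
      then show ?thesis using \<open>even (deg A v)\<close> by auto
    qed
    then show ?thesis using \<open>v \<in> V\<close> deg4 v by auto
  next
    case 2
    then obtain u v where W: "W = {u, v}" "u \<noteq> v" by (auto simp: card_2_iff)
    then have "even (deg A u + deg A v)" using ev by simp
    moreover have "deg A u < 4" "deg A v < 4" using W by (auto simp: W_def)
    ultimately show ?thesis using two_deficient[of u v] clique[of u v] W deg4 by auto
  next
    case 3
    then obtain u v w where W: "W = {u, v, w}" "u \<noteq> v" "v \<noteq> w" "u \<noteq> w" by (auto simp: card_3_iff)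
    then have "even (deg A u + deg A v + deg A w)" using ev by (simp add: add.assoc)
    moreover have "deg A u < 4" "deg A v < 4" "deg A w < 4" using W by (auto simp: W_def)
    ultimately show ?thesis
      using three_deficient[of u v w] clique[of u v] clique[of u w] clique[of v w] W deg4 by auto
  qed
qed

end

section \<open>The spectral radius as a maximal Rayleigh quotient\<close>

text \<open>The vertex type may be infinite; pinning functions to 0 off \<open>V\<close> yields a
  product of compact factors.\<close>

lemma compact_cube:
  fixes V :: "'a set"
  shows "compact {f :: 'a \<Rightarrow> real. (\<forall>v\<in>V. f v \<in> {-1..1}) \<and> (\<forall>v. v \<notin> V \<longrightarrow> f v = 0)}"
proof -
  have "{f :: 'a \<Rightarrow> real. (\<forall>v\<in>V. f v \<in> {-1..1}) \<and> (\<forall>v. v \<notin> V \<longrightarrow> f v = 0)}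
      = PiE UNIV (\<lambda>v. if v \<in> V then {-1..1} else {0})"
    by (fastforce simp: PiE_def Pi_def extensional_def split: if_splits)
  moreover have "compactin (product_topology (\<lambda>_. euclidean) UNIV)
      (PiE UNIV (\<lambda>v. if v \<in> V then {-1..1::real} else {0}))"
    unfolding compactin_PiE by auto
  ultimately show ?thesis
    by (simp add: euclidean_product_topology)
qed

lemma quad_max_eigen:
  assumes V: "finite V" and A: "A \<subseteq> V \<times> V" "sym A" "irrefl A"
    and bound: "\<And>y. quad A y \<le> l * (\<Sum>v\<in>V. (y v)\<^sup>2)"
    and attained: "quad A x = l * (\<Sum>v\<in>V. (x v)\<^sup>2)" and v: "v \<in> V"
  shows "(\<Sum>u\<in>A `` {v}. x u) = l * x v"
proof (rule ccontr)
  have finA: "finite A" using A(1) V by (meson finite_SigmaI finite_subset)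
  define \<rho> where "\<rho> = (\<Sum>u\<in>A `` {v}. x u) - l * x v"
  assume "\<not> ?thesis"
  then have \<rho>: "\<rho> \<noteq> 0" by (simp add: \<rho>_def)
  define y where "y t u = x u + t * of_bool (u = v)" for t u
  have "quad A (y t) = quad A x + 2 * t * (\<Sum>u\<in>A `` {v}. x u)" for t
  proof -
    have "quad A (y t) = (\<Sum>(a, b)\<in>A. x a * x b + t * (of_bool (a = v) * x b) + t * (of_bool (b = v) * x a))"
      unfolding quad_def y_def using A(3)
      by (intro sum.cong) (auto simp: algebra_simps irrefl_def)
    also have "\<dots> = quad A x + t * (\<Sum>(a, b)\<in>A. of_bool (a = v) * x b)
        + t * (\<Sum>(a, b)\<in>A. of_bool (b = v) * x a)"
      by (simp add: quad_def case_prod_unfold sum.distrib sum_distrib_left)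
    also have "(\<Sum>(a, b)\<in>A. of_bool (b = v) * x a) = (\<Sum>(a, b)\<in>A. of_bool (a = v) * x b)"
      using A(2) by (intro sum.reindex_bij_witness[of _ prod.swap prod.swap]) (auto dest: symD)
    finally show ?thesis by (simp add: sum_Image_eq[OF finA])
  qed
  moreover have "(\<Sum>u\<in>V. (y t u)\<^sup>2) = (\<Sum>u\<in>V. (x u)\<^sup>2) + 2 * t * x v + t\<^sup>2" for t
  proof -
    have "(\<Sum>u\<in>V. (y t u)\<^sup>2) = (\<Sum>u\<in>V. (x u)\<^sup>2 + (if u = v then 2 * t * x v + t\<^sup>2 else 0))"
      by (intro sum.cong) (auto simp: y_def power2_eq_square algebra_simps)
    then show ?thesis using V v by (simp add: sum.distrib)
  qed
  ultimately have le: "2 * t * \<rho> \<le> l * t\<^sup>2" for t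
    using bound[of "y t"] attained by (simp add: \<rho>_def algebra_simps)
  \<comment> \<open>The sign of \<open>l\<close> is unknown here, so
    \<open>\<bar>l\<bar> + 1\<close> serves as denominator of the step \<open>t\<close>.\<close>
  have pos: "\<bar>l\<bar> + 1 > 0" by simp
  have "2 * \<rho>\<^sup>2 / (\<bar>l\<bar> + 1) \<le> l * \<rho>\<^sup>2 / (\<bar>l\<bar> + 1)\<^sup>2"
    using le[of "\<rho> / (\<bar>l\<bar> + 1)"] by (simp add: power2_eq_square)
  also have "\<dots> \<le> \<rho>\<^sup>2 / (\<bar>l\<bar> + 1)"
  proof -
    have "l * \<rho>\<^sup>2 \<le> (\<bar>l\<bar> + 1) * \<rho>\<^sup>2" by (intro mult_right_mono) auto
    then have "l * \<rho>\<^sup>2 / (\<bar>l\<bar> + 1)\<^sup>2 \<le> (\<bar>l\<bar> + 1) * \<rho>\<^sup>2 / (\<bar>l\<bar> + 1)\<^sup>2"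
      by (intro divide_right_mono) auto
    also have "(\<bar>l\<bar> + 1) * \<rho>\<^sup>2 / (\<bar>l\<bar> + 1)\<^sup>2 = \<rho>\<^sup>2 / (\<bar>l\<bar> + 1)"
      using pos by (simp add: power2_eq_square del: mult_divide_mult_cancel_left_if)
    finally show ?thesis .
  qed
  finally have "2 * \<rho>\<^sup>2 \<le> \<rho>\<^sup>2" using pos by (simp add: divide_le_cancel)
  then have "\<rho>\<^sup>2 \<le> 0" by simp
  then show False using \<rho> by simp
qed

text \<open>Compactness gives a maximiser on the unit sphere, and passing to absolute values does
  not lower the form because adjacency entries are nonnegative.\<close>

lemma ex_quad_max:
  fixes V :: "'a set"
  assumes V: "finite V" "V \<noteq> {}" and A: "A \<subseteq> V \<times> V" "sym A" "irrefl A"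
  obtains x l where "\<And>v. x v \<ge> 0" "\<exists>v\<in>V. x v > 0"
    "\<And>y. quad A y \<le> l * (\<Sum>v\<in>V. (y v)\<^sup>2)" "\<And>v. v \<in> V \<Longrightarrow> (\<Sum>u\<in>A `` {v}. x u) = l * x v"
proof -
  let ?C = "{f :: 'a \<Rightarrow> real. (\<forall>v\<in>V. f v \<in> {-1..1}) \<and> (\<forall>v. v \<notin> V \<longrightarrow> f v = 0)}"
  let ?N = "\<lambda>f :: 'a \<Rightarrow> real. \<Sum>v\<in>V. (f v)\<^sup>2"
  let ?S = "?C \<inter> {f. ?N f = 1}"
  have coord: "continuous_on UNIV (\<lambda>f :: 'a \<Rightarrow> real. f v)" for v
    by (rule continuous_on_product_coordinates)
  have "continuous_on UNIV ?N" by (intro continuous_intros coord)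
  then have "closed {f. ?N f = 1}" by (intro closed_Collect_eq continuous_on_const)
  then have "compact ?S" using compact_cube compact_Int_closed by blast
  moreover obtain w where w: "w \<in> V" using V by auto
  have "?N (\<lambda>v. of_bool (v = w)) = (\<Sum>v\<in>V. if v = w then 1 else 0)"
    by (intro sum.cong) auto
  then have "(\<lambda>v. of_bool (v = w)) \<in> ?S" using V w by auto
  then have "?S \<noteq> {}" by (metis (no_types, lifting) empty_iff)
  moreover have "continuous_on ?S (quad A)"
    unfolding quad_def case_prod_unfold
    by (intro continuous_intros continuous_on_subset[OF coord]) auto
  ultimately obtain f where f: "f \<in> ?S" and max: "\<And>g. g \<in> ?S \<Longrightarrow> quad A g \<le> quad A f"
    using continuous_attains_sup[of ?S "quad A"] by blast
  define l where "l = quad A f"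
  have bound: "quad A y \<le> l * ?N y" for y
  proof (cases "?N y = 0")
    case True
    then have "\<And>v. v \<in> V \<Longrightarrow> y v = 0" using V by (simp add: sum_nonneg_eq_0_iff)
    then have "quad A y = 0" unfolding quad_def using A(1) by (intro sum.neutral) auto
    then show ?thesis using True by simp
  next
    case False
    then have pos: "?N y > 0" by (simp add: less_le sum_nonneg)
    define r where "r = sqrt (?N y)"
    have r: "r > 0" "r\<^sup>2 = ?N y" using pos by (simp_all add: r_def)
    define g where "g v = (if v \<in> V then y v / r else 0)" for v
    have N: "?N g = 1"
      using r pos by (simp add: g_def power_divide flip: sum_divide_distrib)
    have "g v \<in> {-1..1}" if "v \<in> V" for v
    proof -
      have "(g v)\<^sup>2 \<le> 1" unfolding N[symmetric] using V that
        by (intro member_le_sum) auto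
      then show ?thesis by (simp add: abs_le_square_iff[of _ 1, simplified, symmetric] abs_le_iff)
    qed
    then have "quad A g \<le> l" unfolding l_def using N by (intro max) (auto simp: g_def)
    moreover have "quad A y = r\<^sup>2 * quad A g"
      unfolding quad_def sum_distrib_left using A(1) r
      by (intro sum.cong) (auto simp: g_def power2_eq_square)
    ultimately show ?thesis
      using mult_right_mono[of "quad A g" l "?N y"] pos r(2) by (simp add: mult.commute)
  qed
  define x where "x v = \<bar>f v\<bar>" for v
  have Nx: "?N x = 1" using f by (simp add: x_def)
  have "l \<le> quad A x"
    unfolding l_def quad_def by (intro sum_mono) (auto simp: x_def simp flip: abs_mult)
  then have "quad A x = l * ?N x" using bound[of x] Nx by simp
  then have eig: "(\<Sum>u\<in>A `` {v}. x u) = l * x v" if "v \<in> V" for v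
    using quad_max_eigen[OF V(1) A bound _ that] by blast
  have "\<exists>v\<in>V. x v > 0"
  proof (rule ccontr)
    assume "\<not> ?thesis"
    then have "?N x = 0" by (intro sum.neutral) (auto simp: x_def)
    then show False using Nx by simp
  qed
  then show ?thesis using that[of x l] bound eig by (simp add: x_def)
qed

lemma pair_graph_simple:
  assumes "pair_graph G"
  shows "finite (pverts G)" "parcs G \<subseteq> pverts G \<times> pverts G" "sym (parcs G)" "irrefl (parcs G)"
proof -
  interpret pair_graph G by fact
  show "finite (pverts G)" by (rule pair_finite_verts)
  show "parcs G \<subseteq> pverts G \<times> pverts G" using in_arcsD1 in_arcsD2 by auto
  show "sym (parcs G)" using pair_sym_arcs by (simp add: symmetric_def)
  show "irrefl (parcs G)" using pair_no_loops[of "(a, a)" for a] by (auto simp: irrefl_def)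
qed

text \<open>The maximal Rayleigh quotient is an eigenvalue, and every eigenvalue is a Rayleigh
  quotient of its eigenvector.\<close>

lemma graph_spectral_radius_quad:
  assumes G: "pair_graph G" and ne: "pverts G \<noteq> {}"
  obtains x where "\<And>v. x v \<ge> 0" "\<exists>v\<in>pverts G. x v > 0"
    "\<And>y. quad (parcs G) y \<le> graph_spectral_radius G * (\<Sum>v\<in>pverts G. (y v)\<^sup>2)"
    "\<And>v. v \<in> pverts G \<Longrightarrow> (\<Sum>u\<in>parcs G `` {v}. x u) = graph_spectral_radius G * x v"
proof -
  define V A where "V = pverts G" and "A = parcs G"
  note simple = pair_graph_simple[OF G, folded V_def A_def]
  have ne: "V \<noteq> {}" using ne by (simp add: V_def)
  obtain x l where x: "\<And>v. x v \<ge> 0" "\<exists>v\<in>V. x v > 0"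
    and bound: "\<And>y. quad A y \<le> l * (\<Sum>v\<in>V. (y v)\<^sup>2)"
    and eig: "\<And>v. v \<in> V \<Longrightarrow> (\<Sum>u\<in>A `` {v}. x u) = l * x v"
    using ex_quad_max[OF simple(1) ne simple(2-4)] by metis
  have nbsum: "(\<Sum>u\<in>V. if (v, u) \<in> A then f u else 0) = (\<Sum>u\<in>A `` {v}. f u)" for f :: "'a \<Rightarrow> real" and v
    using simple(1,2) by (intro sum.mono_neutral_cong_right) (auto split: if_splits)
  have ev: "eigenvalue (adjacency_mat G) k \<longleftrightarrow>
      (\<exists>f. (\<exists>v\<in>V. f v \<noteq> 0) \<and> (\<forall>v\<in>V. (\<Sum>u\<in>A `` {v}. f u) = k * f v))" for k
    using eigenvalue_adjacency_mat_iff[OF pair_graph_simple(1)[OF G]]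
    by (simp add: nbsum flip: V_def A_def)
  have "graph_spectral_radius G = l"
    unfolding graph_spectral_radius_def
  proof (rule Max_eqI)
    show "finite (spectrum (adjacency_mat G))"
      using graph_spectral_radius_wellformed[OF G] ne by (simp add: V_def)
    show "l \<in> spectrum (adjacency_mat G)"
    proof -
      have "\<exists>v\<in>V. x v \<noteq> 0" using x(2) by (metis less_irrefl)
      then have "eigenvalue (adjacency_mat G) l" unfolding ev using eig by blast
      then show ?thesis by (simp add: spectrum_def)
    qed
    fix k assume "k \<in> spectrum (adjacency_mat G)"
    then obtain f v where f: "v \<in> V" "f v \<noteq> 0" "\<And>v. v \<in> V \<Longrightarrow> (\<Sum>u\<in>A `` {v}. f u) = k * f v"
      by (auto simp: spectrum_def ev)
    have "quad A f = (\<Sum>v\<in>V. \<Sum>u\<in>A `` {v}. f v * f u)"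
      unfolding quad_def by (rule sum_arcs_by_tail[OF simple(1,2)])
    also have "\<dots> = (\<Sum>v\<in>V. k * (f v)\<^sup>2)"
      by (intro sum.cong) (simp_all add: f(3) power2_eq_square flip: sum_distrib_left)
    finally have "k * (\<Sum>v\<in>V. (f v)\<^sup>2) \<le> l * (\<Sum>v\<in>V. (f v)\<^sup>2)"
      using bound[of f] by (simp add: sum_distrib_left)
    moreover have "(\<Sum>v\<in>V. (f v)\<^sup>2) > 0"
      using f simple(1) by (intro sum_pos2[of _ v]) auto
    ultimately show "k \<le> l" by simp
  qed
  then show ?thesis using that x bound eig unfolding V_def A_def by blast
qed

lemma vdegree_eq_deg: "vdegree G v = deg (parcs G) v"
proof -
  have "bij_betw snd {e \<in> parcs G. fst e = v} (parcs G `` {v})"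
    by (rule bij_betw_byWitness[of _ "\<lambda>u. (v, u)"]) auto
  then show ?thesis
    by (simp add: vdegree_def deg_def out_degree_def out_arcs_def bij_betw_same_card)
qed

lemma connected_iff_rtrancl:
  assumes "pair_graph G"
  shows "Digraph_Component.connected (with_proj G) \<longleftrightarrow>
    pverts G \<noteq> {} \<and> pverts G \<times> pverts G \<subseteq> (parcs G)\<^sup>*"
proof -
  note simple = pair_graph_simple[OF assms]
  have arcs: "parcs (mk_symmetric (with_proj G)) = parcs G"
    using simple(3) by (auto simp: parcs_mk_symmetric dest: symD)
  have "(u, v) \<in> rtrancl_on (pverts G) (parcs G) \<longleftrightarrow> (u, v) \<in> (parcs G)\<^sup>*" if "u \<in> pverts G" for u v
  proof
    assume "(u, v) \<in> (parcs G)\<^sup>*"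
    then show "(u, v) \<in> rtrancl_on (pverts G) (parcs G)"
      using that simple(2)
      by (induction rule: rtrancl_induct) (auto intro: rtrancl_on_into_rtrancl_on)
  qed (rule rtrancl_on_rtranclI)
  then show ?thesis
    by (auto simp: Digraph_Component.connected_def strongly_connected_def reachable_def arcs)
qed

lemma connected_nonregular_graph_iff:
  "connected_nonregular_graph n 4 G \<longleftrightarrow>
     card (pverts G) = n \<and> finite (pverts G) \<and> admissible (pverts G) (parcs G)"
proof
  assume G: "connected_nonregular_graph n 4 G"
  then have pg: "pair_graph G" by (simp add: connected_nonregular_graph_def)
  note simple = pair_graph_simple[OF pg]
  have ne: "pverts G \<noteq> {}" and conn: "pverts G \<times> pverts G \<subseteq> (parcs G)\<^sup>*"
    using G connected_iff_rtrancl[OF pg] by (auto simp: connected_nonregular_graph_def)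
  have Max: "Max (deg (parcs G) ` pverts G) = 4"
    using G by (simp add: connected_nonregular_graph_def max_degree_def vdegree_eq_deg[abs_def])
  have le: "deg (parcs G) v \<le> 4" if "v \<in> pverts G" for v
    using that simple(1) by (simp flip: Max)
  moreover have "4 \<in> deg (parcs G) ` pverts G"
    using Max_in[of "deg (parcs G) ` pverts G"] Max simple(1) ne by simp
  then have "\<exists>v\<in>pverts G. deg (parcs G) v = 4" by auto
  moreover have "\<exists>v\<in>pverts G. deg (parcs G) v < 4"
  proof -
    obtain u v where "u \<in> pverts G" "v \<in> pverts G" "deg (parcs G) u \<noteq> deg (parcs G) v"
      using G by (auto simp: connected_nonregular_graph_def nonregular_def vdegree_eq_deg)
    then show ?thesis using le[of u] le[of v] by (metis le_neq_implies_less)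
  qed
  ultimately show "card (pverts G) = n \<and> finite (pverts G) \<and> admissible (pverts G) (parcs G)"
    using simple conn G by (auto simp: admissible_def connected_nonregular_graph_def)
next
  assume *: "card (pverts G) = n \<and> finite (pverts G) \<and> admissible (pverts G) (parcs G)"
  then have fin: "finite (pverts G)" and sub: "parcs G \<subseteq> pverts G \<times> pverts G"
    and "sym (parcs G)" "irrefl (parcs G)"
    and degs: "\<exists>v\<in>pverts G. deg (parcs G) v = 4" "\<exists>v\<in>pverts G. deg (parcs G) v < 4"
      "\<forall>v\<in>pverts G. deg (parcs G) v \<le> 4"
    by (auto simp: admissible_def)
  then have pg: "pair_graph G"
    by unfold_locales
      (auto simp: symmetric_def irrefl_def intro: finite_subset[OF sub] finite_cartesian_product)
  have "max_degree G = 4"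
    unfolding max_degree_def using degs fin by (intro Max_eqI) (auto simp: vdegree_eq_deg)
  moreover have "nonregular G"
    using degs unfolding nonregular_def vdegree_eq_deg by (metis less_irrefl)
  ultimately show "connected_nonregular_graph n 4 G"
    using * pg connected_iff_rtrancl[OF pg]
    by (auto simp: connected_nonregular_graph_def admissible_def)
qed

lemma extremal_graph:
  fixes G :: "'a pair_pre_digraph"
  assumes n: "n \<ge> 10" and G: "connected_nonregular_graph n 4 G"
    and max: "\<forall>H :: 'a pair_pre_digraph. connected_nonregular_graph n 4 H \<longrightarrow>
      graph_spectral_radius H \<le> graph_spectral_radius G"
  obtains x where "extremal (pverts G) (parcs G) x (graph_spectral_radius G)"
proof -
  define V where "V = pverts G"
  have V: "card V = n" "finite V" and adm: "admissible V (parcs G)"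
    using G by (auto simp: connected_nonregular_graph_iff V_def)
  have pg: "pair_graph G" using G by (simp add: connected_nonregular_graph_def)
  have ne: "V \<noteq> {}" using V n by auto
  obtain x where x: "\<And>v. x v \<ge> 0" "\<exists>v\<in>V. x v > 0"
    and eig: "\<And>v. v \<in> V \<Longrightarrow> (\<Sum>u\<in>parcs G `` {v}. x u) = graph_spectral_radius G * x v"
    using graph_spectral_radius_quad[OF pg] ne unfolding V_def by metis
  have "extremal V (parcs G) x (graph_spectral_radius G)"
  proof
    show "finite V" "10 \<le> card V" "admissible V (parcs G)" using V adm n by auto
    show "(\<Sum>u\<in>parcs G `` {v}. x u) = graph_spectral_radius G * x v" if "v \<in> V" for v
      using eig[OF that] .
    \<comment> \<open>The zeros of a nonnegative eigenvector are closed under adjacency, so in a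
      connected graph one zero would spread everywhere.\<close>
    show "x v > 0" if v: "v \<in> V" for v
    proof (rule ccontr)
      assume "\<not> x v > 0"
      then have "v \<in> {u \<in> V. x u = 0}" using x(1)[of v] v by auto
      moreover have "b \<in> {u \<in> V. x u = 0}" if "a \<in> {u \<in> V. x u = 0}" "(a, b) \<in> parcs G" for a b
      proof -
        have "finite (parcs G `` {a})"
          using pair_graph_simple(1,2)[OF pg] by (meson finite_Image finite_SigmaI finite_subset)
        moreover have "(\<Sum>u\<in>parcs G `` {a}. x u) = 0" using that eig[of a] by simp
        ultimately have "x b = 0" using x(1) that(2) by (simp add: sum_nonneg_eq_0_iff)
        then show ?thesis using that adm by (auto simp: admissible_def)
      qed
      moreover have "(v, w) \<in> (parcs G)\<^sup>*" if "w \<in> V" for w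
        using adm v that by (auto simp: admissible_def)
      ultimately have "x w = 0" if "w \<in> V" for w
        using rtrancl_closed[of v w "parcs G" "{u \<in> V. x u = 0}"] that by blast
      then show False using x(2) by force
    qed
    show "quad B y \<le> graph_spectral_radius G * (\<Sum>v\<in>V. (y v)\<^sup>2)" if B: "admissible V B" for B y
    proof -
      define H where "H = \<lparr>pverts = V, parcs = B\<rparr>"
      have H: "connected_nonregular_graph n 4 H"
        using V B by (simp add: connected_nonregular_graph_iff H_def)
      then have "pair_graph H" by (simp add: connected_nonregular_graph_def)
      then have "quad B y \<le> graph_spectral_radius H * (\<Sum>v\<in>V. (y v)\<^sup>2)"
        using graph_spectral_radius_quad[of H] ne by (metis H_def pair_pre_digraph.select_convs(1,2))
      also have "\<dots> \<le> graph_spectral_radius G * (\<Sum>v\<in>V. (y v)\<^sup>2)"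
        using max H by (intro mult_right_mono sum_nonneg) auto
      finally show ?thesis .
    qed
  qed
  then show ?thesis using that unfolding V_def by blast
qed

theorem theorem5p10:
  fixes G :: "'a pair_pre_digraph" and n :: nat
  assumes "n \<ge> 10"
    and "connected_nonregular_graph n 4 G"
    and "\<forall>H :: 'a pair_pre_digraph. connected_nonregular_graph n 4 H \<longrightarrow>
           graph_spectral_radius H \<le> graph_spectral_radius G"
  shows "\<exists>v\<in>pverts G. vdegree G v = 2 \<and> (\<forall>u\<in>pverts G - {v}. vdegree G u = 4)"
proof -
  obtain x where "extremal (pverts G) (parcs G) x (graph_spectral_radius G)"
    using extremal_graph[OF assms] by blast
  then show ?thesis
    unfolding vdegree_eq_deg by (rule extremal.degree_sequence)
qed

end
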